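(* Let $n\geq s\geq 2$ be integers, and let $\mathcal F\subseteq S_n$ satisfy $\nu(\mathcal F)<s$, i.e. $\mathcal F$ contains no $s$ pairwise disjoint permutations. Then \[ |\mathcal F|\leq (s-1)(n-1)!. \] Equality $|\mathcal F|=(s-1)(n-1)!$ holds if and only if one of the following holds: (i) there are $i\in[n]$ and $J\subseteq[n]$ with $|J|=s-1$ such that $\mathcal F=\{\sigma\in S_n:\sigma(i)\in J\}$; (ii) there are $j\in[n]$ and $I\subseteq[n]$ with $|I|=s-1$ such that $\mathcal F=\{\sigma\in S_n:\sigma^{-1}(j)\in I\}$.
   Context: $S_n$ is the symmetric group on $[n]=\{1,\ldots,n\}$. Two permutations $\sigma,\tau\in S_n$ are called disjoint if $\sigma(i)\neq\tau(i)$ for every $i\in[n]$. For $\mathcal F\subseteq S_n$, $\nu(\mathcal F)$ denotes the maximum size of a subfamily of $\mathcal F$ consisting of pairwise disjoint permutations. *)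

theory Defs
  imports "HOL-Combinatorics.Permutations"
begin

abbreviation Sym :: "nat \<Rightarrow> (nat \<Rightarrow> nat) set" where
  "Sym n \<equiv> {\<sigma>. \<sigma> permutes {1..n}}"

definition disjoint_perms :: "nat \<Rightarrow> (nat \<Rightarrow> nat) \<Rightarrow> (nat \<Rightarrow> nat) \<Rightarrow> bool" where
  "disjoint_perms n \<sigma> \<tau> \<longleftrightarrow> (\<forall>i\<in>{1..n}. \<sigma> i \<noteq> \<tau> i)"

(* pairwise only compares distinct members of G. The set under Max contains 0 (take G empty),
   and it is finite for F a subset of Sym n. *)
definition matching_number :: "nat \<Rightarrow> (nat \<Rightarrow> nat) set \<Rightarrow> nat" where
  "matching_number n F = Max {card G |G. G \<subseteq> F \<and> pairwise (disjoint_perms n) G}"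

end

theory Submission
  imports Defs
begin

text \<open>
  A set of pairwise disjoint permutations is a Latin rectangle, and by Hall's theorem it extends to a
  Latin square. Averaging over the translates of a Latin square gives the bound, and in the extremal
  case the indicator \<open>f\<close> of the family has the same sum over every Latin square. Switching two
  rows of a Latin square on a union of cycles then yields
  \<open>f g + f (g t u) = f (g t) + f (g u)\<close> for all disjoint transpositions \<open>t\<close>, \<open>u\<close>,
  provided \<open>n \<ge> 4\<close>.

  Hence \<open>f g - f (g (a b))\<close> depends only on \<open>a, b, g a, g b\<close> and is additive both in the
  positions and in the values, so the positions \<open>a, b\<close> on which it is not identically zero, and
  for fixed \<open>a, b\<close> the values on which it is nonzero, form complete multipartite graphs. As
  \<open>f\<close> is Boolean, two disjoint transpositions cannot both change \<open>f\<close> at the same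
  \<open>g\<close>, so the value graphs of disjoint pairs of positions are cross-intersecting and thus
  stars with a common centre. Either the position graph is a star, and \<open>f g\<close> depends on one
  value \<open>g i\<close>, or it has two disjoint edges, and then all value graphs are concentrated at
  the same \<open>j\<close> and \<open>f g\<close> depends only on the preimage of \<open>j\<close>. For
  \<open>n \<le> 3\<close> the family or its complement is an intersecting family of at most two
  permutations.
\<close>

section \<open>Hall's marriage theorem\<close>

text \<open>Induction on \<open>card X\<close>. If a nonempty proper subset satisfies the condition
  with equality, it and its complement can be matched separately. Otherwise every such subset has a
  spare value, so any choice for one element keeps the condition for the rest.\<close>

lemma hall_marriage:
  assumes "finite X" "\<And>x. x \<in> X \<Longrightarrow> finite (A x)"
    and "\<And>S. S \<subseteq> X \<Longrightarrow> card S \<le> card (\<Union>(A ` S))"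
  shows "\<exists>r. inj_on r X \<and> (\<forall>x\<in>X. r x \<in> A x)"
  using assms
proof (induction "card X" arbitrary: X A rule: less_induct)
  case less
  note fin = less.prems(1) and finA = less.prems(2) and cond = less.prems(3)
  have finU: "finite (\<Union>(A ` S))" if "S \<subseteq> X" for S
    using that fin finA finite_subset by blast
  show ?case
  proof (cases "\<exists>S. S \<subset> X \<and> S \<noteq> {} \<and> card (\<Union>(A ` S)) = card S")
    case True
    then obtain S where S: "S \<subset> X" "S \<noteq> {}" "card (\<Union>(A ` S)) = card S" by blast
    define N where "N = \<Union>(A ` S)"
    have finS: "finite S" using S fin finite_subset by blast
    have "\<exists>r. inj_on r S \<and> (\<forall>x\<in>S. r x \<in> A x)"
      using S fin finA cond by (intro less.hyps psubset_card_mono finS) auto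
    then obtain r1 where r1: "inj_on r1 S" "\<forall>x\<in>S. r1 x \<in> A x" by blast
    have "\<exists>r. inj_on r (X - S) \<and> (\<forall>x\<in>X - S. r x \<in> A x - N)"
    proof (intro less.hyps)
      show "card (X - S) < card X" using S fin by (intro psubset_card_mono) auto
      fix T assume T: "T \<subseteq> X - S"
      have finT: "finite T" using T fin finite_subset by blast
      \<comment> \<open>The condition for \<open>S \<union> T\<close>, less the
        \<open>card S\<close> values of \<open>N\<close>, is the condition for \<open>T\<close>
        outside \<open>N\<close>.\<close>
      have eq: "\<Union>(A ` (S \<union> T)) = N \<union> (\<Union>x\<in>T. A x - N)" by (auto simp: N_def)
      have "card S + card T = card (S \<union> T)"
        using T finS finT by (subst card_Un_disjoint) auto
      also have "\<dots> \<le> card (\<Union>(A ` (S \<union> T)))" using T S by (intro cond) auto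
      also have "\<dots> \<le> card N + card (\<Union>x\<in>T. A x - N)"
        unfolding eq by (rule card_Un_le)
      finally show "card T \<le> card (\<Union>x\<in>T. A x - N)" using S by (simp add: N_def)
    qed (use fin finA in auto)
    then obtain r2 where r2: "inj_on r2 (X - S)" "\<forall>x\<in>X - S. r2 x \<in> A x - N" by blast
    have sub: "r1 x \<in> N" if "x \<in> S" for x using r1 that by (auto simp: N_def)
    define r where "r = (\<lambda>x. if x \<in> S then r1 x else r2 x)"
    have r_S: "r x = r1 x" if "x \<in> S" for x using that by (simp add: r_def)
    have r_X: "r x = r2 x" if "x \<in> X - S" for x using that by (simp add: r_def)
    have "inj_on r (S \<union> (X - S))"
      unfolding inj_on_Un
    proof (intro conjI)
      show "inj_on r S" using r1(1) r_S by (simp cong: inj_on_cong)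
      show "inj_on r (X - S)" using r2(1) r_X unfolding inj_on_def by auto
      show "r ` (S - (X - S)) \<inter> r ` (X - S - S) = {}"
        using sub r2(2) r_S r_X by fastforce
    qed
    moreover have "S \<union> (X - S) = X" using S by auto
    moreover have "\<forall>x\<in>X. r x \<in> A x" using r1 r2 by (simp add: r_def)
    ultimately show ?thesis by auto
  next
    case False
    then have big: "card T < card (\<Union>(A ` T))" if "T \<subset> X" "T \<noteq> {}" for T
      using that cond[of T] by (metis le_neq_implies_less psubset_imp_subset)
    show ?thesis
    proof (cases "X = {}")
      case False
      then obtain x where x: "x \<in> X" by blast
      have "card (A x) \<ge> 1" using cond[of "{x}"] x by simp
      then obtain y where y: "y \<in> A x" by (metis card.empty ex_in_conv not_one_le_zero)
      have "\<exists>r. inj_on r (X - {x}) \<and> (\<forall>z\<in>X - {x}. r z \<in> A z - {y})"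
      proof (intro less.hyps)
        show "card (X - {x}) < card X" using x fin by (intro psubset_card_mono) auto
        fix T assume T: "T \<subseteq> X - {x}"
        show "card T \<le> card (\<Union>z\<in>T. A z - {y})"
        proof (cases "T = {}")
          case False
          \<comment> \<open>Deleting \<open>y\<close> costs at most one value, which the strict
            inequality \<open>big\<close> can spare.\<close>
          have "(\<Union>z\<in>T. A z - {y}) = \<Union>(A ` T) - {y}" by auto
          moreover have "card (\<Union>(A ` T)) \<le> Suc (card (\<Union>(A ` T) - {y}))"
            by (metis card_Diff1_le card_Diff_singleton_if diff_Suc_1 le_Suc_eq Suc_pred not_gr_zero zero_le)
          moreover have "card T < card (\<Union>(A ` T))" using T x False by (intro big) auto
          ultimately show ?thesis by simp
        qed simp
      qed (use fin finA in auto)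
      then obtain r where r: "inj_on r (X - {x})" "\<forall>z\<in>X - {x}. r z \<in> A z - {y}" by blast
      have "inj_on (r(x := y)) (insert x (X - {x}))"
        using r by (intro inj_on_insert[THEN iffD2] conjI inj_on_fun_updI) auto
      moreover have "insert x (X - {x}) = X" using x by auto
      moreover have "\<forall>z\<in>X. (r(x := y)) z \<in> A z" using r y by simp
      ultimately show ?thesis by auto
    qed simp
  qed
qed

subsection \<open>Latin rectangles\<close>

text \<open>The rows form an unordered set; a Latin square is the case
  \<open>card L = card V\<close>. The carrier is arbitrary because rectangles are also built on
  subsets of the point set.\<close>

definition latin_rectangle :: "'a set \<Rightarrow> ('a \<Rightarrow> 'a) set \<Rightarrow> bool" where
  "latin_rectangle V L \<longleftrightarrow>
     L \<subseteq> {p. p permutes V} \<and> pairwise (\<lambda>p q. \<forall>x\<in>V. p x \<noteq> q x) L"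

text \<open>The graph joining each column to the values missing from it is regular of degree
  \<open>card V - card L\<close>, since every value occurs once in each row. Double counting its
  edges gives Hall's condition, and the matching is the new row.\<close>

lemma latin_rectangle_extend_row:
  assumes fin: "finite V" and L: "latin_rectangle V L" and less: "card L < card V"
  shows "\<exists>p. p permutes V \<and> (\<forall>q\<in>L. \<forall>x\<in>V. p x \<noteq> q x)"
proof -
  have finL: "finite L"
    using L fin finite_permutations finite_subset by (auto simp: latin_rectangle_def)
  have Lp: "q permutes V" if "q \<in> L" for q using L that by (auto simp: latin_rectangle_def)
  have Ld: "p x \<noteq> q x" if "p \<in> L" "q \<in> L" "p \<noteq> q" "x \<in> V" for p q x
    using L that by (auto simp: latin_rectangle_def pairwise_def)
  define A where "A = (\<lambda>x. V - (\<lambda>q. q x) ` L)"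
  define k where "k = card V - card L"
  have k: "k > 0" using less by (simp add: k_def)
  have cardA: "card (A x) = k" if "x \<in> V" for x
  proof -
    have "inj_on (\<lambda>q. q x) L" using Ld that by (auto simp: inj_on_def)
    moreover have "(\<lambda>q. q x) ` L \<subseteq> V" using Lp that permutes_in_image by fastforce
    ultimately show ?thesis
      unfolding A_def k_def using finL by (simp add: card_Diff_subset card_image)
  qed
  have cardB: "card {x \<in> V. y \<in> A x} = k" if "y \<in> V" for y
  proof -
    have inv: "q (inv q y) = y" "inv q y \<in> V" if "q \<in> L" for q
      using Lp[OF that] \<open>y \<in> V\<close> permutes_inverses(1) permutes_inv permutes_in_image by metis+
    have "inj_on (\<lambda>q. inv q y) L" using Ld inv by (auto simp: inj_on_def) metis
    moreover have "(\<lambda>q. inv q y) ` L \<subseteq> V" using inv by auto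
    moreover have "{x \<in> V. y \<in> A x} = V - (\<lambda>q. inv q y) ` L"
    proof -
      have "y = q x \<longleftrightarrow> x = inv q y" if "q \<in> L" for q x
        using permutes_inv_eq[OF Lp[OF that]] by metis
      then show ?thesis using that by (auto simp: A_def image_iff)
    qed
    ultimately show ?thesis
      unfolding k_def using finL by (simp add: card_Diff_subset card_image)
  qed
  have hall: "card S \<le> card (\<Union>(A ` S))" if S: "S \<subseteq> V" for S
  proof -
    define N where "N = \<Union>(A ` S)"
    have NV: "N \<subseteq> V" by (auto simp: N_def A_def)
    have finS: "finite S" and finN: "finite N" using S NV fin finite_subset by auto
    have "card S * k = (\<Sum>x\<in>S. card {y \<in> N. y \<in> A x})"
    proof -
      have "{y \<in> N. y \<in> A x} = A x" if "x \<in> S" for x using that by (auto simp: N_def)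
      then show ?thesis using cardA S by (simp add: subset_iff)
    qed
    also have "\<dots> = (\<Sum>y\<in>N. card {x \<in> S. y \<in> A x})"
      using finS finN by (intro sum_multicount_gen) auto
    also have "\<dots> \<le> (\<Sum>y\<in>N. k)"
    proof (intro sum_mono)
      fix y assume "y \<in> N"
      then have "card {x \<in> V. y \<in> A x} = k" using NV cardB by auto
      moreover have "card {x \<in> S. y \<in> A x} \<le> card {x \<in> V. y \<in> A x}"
        using S fin by (intro card_mono) auto
      ultimately show "card {x \<in> S. y \<in> A x} \<le> k" by simp
    qed
    finally show ?thesis using k by (simp add: N_def)
  qed
  have "\<exists>r. inj_on r V \<and> (\<forall>x\<in>V. r x \<in> A x)"
    using fin hall by (intro hall_marriage) (auto simp: A_def)
  then obtain r where r: "inj_on r V" "\<forall>x\<in>V. r x \<in> A x" by blast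
  have rV: "r ` V \<subseteq> V" using r by (auto simp: A_def)
  define p where "p = (\<lambda>x. if x \<in> V then r x else x)"
  have "bij_betw p V V"
    using endo_inj_surj[OF fin rV r(1)] r(1) by (auto simp: bij_betw_def p_def inj_on_def)
  then have "p permutes V" by (rule bij_imp_permutes) (auto simp: p_def)
  moreover have "p x \<noteq> q x" if "q \<in> L" "x \<in> V" for q x
    using r that by (auto simp: p_def A_def)
  ultimately show ?thesis by blast
qed

lemma latin_rectangle_insert:
  assumes "latin_rectangle V L" "p permutes V" "\<And>q x. q \<in> L \<Longrightarrow> x \<in> V \<Longrightarrow> p x \<noteq> q x"
  shows "latin_rectangle V (insert p L)"
  using assms unfolding latin_rectangle_def pairwise_insert by force

lemma latin_rectangle_complete:
  assumes fin: "finite V" and "latin_rectangle V L" "card L \<le> card V" 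
  shows "\<exists>M. L \<subseteq> M \<and> latin_rectangle V M \<and> card M = card V"
  using assms(2,3)
proof (induction "card V - card L" arbitrary: L)
  case 0
  then show ?case by auto
next
  case (Suc d)
  then have less: "card L < card V" by simp
  then obtain p where p: "p permutes V" "\<And>q x. q \<in> L \<Longrightarrow> x \<in> V \<Longrightarrow> p x \<noteq> q x"
    using latin_rectangle_extend_row[OF fin Suc.prems(1)] by blast
  have finL: "finite L"
    using Suc.prems fin finite_permutations finite_subset by (auto simp: latin_rectangle_def)
  have "p \<notin> L" using p(2) less by (metis card_gt_0_iff ex_in_conv not_gr_zero less_nat_zero_code)
  then have c: "card (insert p L) = Suc (card L)" using finL by simp
  have "\<exists>M. insert p L \<subseteq> M \<and> latin_rectangle V M \<and> card M = card V"
    using Suc.hyps(2) less c p Suc.prems(1)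
    by (intro Suc.hyps(1) latin_rectangle_insert) auto
  then show ?case by blast
qed

lemma latin_rectangle_doubleton:
  assumes "p permutes V" "q permutes V" "\<And>x. x \<in> V \<Longrightarrow> p x \<noteq> q x"
  shows "latin_rectangle V {p, q}"
  using assms by (fastforce simp: latin_rectangle_def pairwise_def)

lemma latin_rectangle_translate:
  assumes "latin_rectangle V L" "g permutes V"
  shows "latin_rectangle V ((\<circ>) g ` L)"
  using assms permutes_compose[of _ V g] permutes_inj[OF assms(2)]
  by (fastforce simp: latin_rectangle_def pairwise_def inj_eq)

lemma latin_rectangle_translate_right:
  assumes "latin_rectangle V L" "g permutes V"
  shows "latin_rectangle V ((\<lambda>p. p \<circ> g) ` L)"
  using assms permutes_compose[OF assms(2)] permutes_in_image[OF assms(2)]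
  by (fastforce simp: latin_rectangle_def pairwise_def)

text \<open>A derangement is a second row under the identity row.\<close>

lemma exists_derangement:
  assumes "finite V" "card V \<ge> 2"
  obtains p where "p permutes V" "\<And>x. x \<in> V \<Longrightarrow> p x \<noteq> x"
proof -
  have "latin_rectangle V {id}" by (auto simp: latin_rectangle_def permutes_id)
  from latin_rectangle_extend_row[OF assms(1) this] assms(2) show ?thesis
    by (auto intro: that)
qed

section \<open>Averaging over the translates of a Latin square\<close>

text \<open>Every left translate of a Latin square is a Latin square, so the average of
  \<open>card (F \<inter> g L)\<close> over all \<open>g\<close> is a multiple of \<open>card F\<close>;
  in the extremal case no translate can fall below the average.\<close>

lemma latin_intersection_average:
  fixes F :: "('a \<Rightarrow> 'a) set"
  assumes fin: "finite V" and ne: "V \<noteq> {}" and F: "F \<subseteq> {p. p permutes V}"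
    and bound: "\<And>L. latin_rectangle V L \<Longrightarrow> card (F \<inter> L) \<le> k"
  shows "card F \<le> k * fact (card V - 1)"
    and "\<lbrakk>card F = k * fact (card V - 1); latin_rectangle V L; card L = card V\<rbrakk>
      \<Longrightarrow> card (F \<inter> L) = k"
proof -
  let ?S = "{p. p permutes V}"
  have finS: "finite ?S" and cardS: "card ?S = fact (card V)"
    using fin by (simp_all add: finite_permutations card_permutations)
  have finF: "finite F" using F finS finite_subset by blast
  have n: "card V > 0" using fin ne by (simp add: card_gt_0_iff)
  have f: "fact (card V) = card V * fact (card V - 1)" 
    using n fact_reduce[of "card V", where 'a=nat] by simp
  have total: "(\<Sum>g\<in>?S. card (F \<inter> (\<circ>) g ` L)) = card V * card F"
    if L: "latin_rectangle V L" "card L = card V" for L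
  proof -
    have Lp: "L \<subseteq> ?S" using L by (simp add: latin_rectangle_def)
    have finL: "finite L" using Lp finS finite_subset by blast
    have "card (F \<inter> (\<circ>) g ` L) = card {l \<in> L. g \<circ> l \<in> F}" if "g \<in> ?S" for g
    proof -
      have "F \<inter> (\<circ>) g ` L = (\<circ>) g ` {l \<in> L. g \<circ> l \<in> F}" by auto
      moreover have "inj_on ((\<circ>) g) {l \<in> L. g \<circ> l \<in> F}"
        using that fun.inj_map[OF permutes_inj, of g V] by (auto intro: inj_on_subset)
      ultimately show ?thesis by (simp add: card_image)
    qed
    then have "(\<Sum>g\<in>?S. card (F \<inter> (\<circ>) g ` L)) = (\<Sum>g\<in>?S. card {l \<in> L. g \<circ> l \<in> F})"
      by (rule sum.cong[OF refl])
    \<comment> \<open>For a fixed row \<open>l\<close>, composition with \<open>l\<close> permutes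
      the symmetric group, so every row contributes \<open>card F\<close>.\<close>
    also have "\<dots> = (\<Sum>l\<in>L. card F)"
    proof (intro sum_multicount_gen finS finL ballI)
      fix l assume l: "l \<in> L"
      then have lp: "l permutes V" using Lp by auto
      have "bij_betw (\<lambda>g. g \<circ> l) {g \<in> ?S. g \<circ> l \<in> F} F"
      proof (rule bij_betw_byWitness[where f' = "\<lambda>h. h \<circ> inv l"])
        show "\<forall>a\<in>{g \<in> ?S. g \<circ> l \<in> F}. a \<circ> l \<circ> inv l = a"
          using lp by (simp add: comp_assoc permutes_inv_o)
        show "\<forall>h\<in>F. h \<circ> inv l \<circ> l = h"
          using lp by (simp add: comp_assoc permutes_inv_o)
        show "(\<lambda>h. h \<circ> inv l) ` F \<subseteq> {g \<in> ?S. g \<circ> l \<in> F}"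
          using lp F by (auto simp: comp_assoc permutes_inv_o intro!: permutes_compose permutes_inv)
      qed auto
      then show "card {g \<in> ?S. g \<circ> l \<in> F} = card F" by (rule bij_betw_same_card)
    qed
    finally show ?thesis using L by simp
  qed
  have each: "card (F \<inter> (\<circ>) g ` L) \<le> k" if "latin_rectangle V L" "g \<in> ?S" for g L
    using that by (intro bound latin_rectangle_translate) auto
  have upper: "(\<Sum>g\<in>?S. k) = card V * (k * fact (card V - 1))" using cardS f by simp
  show "card F \<le> k * fact (card V - 1)"
  proof -
    have "latin_rectangle V {}" by (simp add: latin_rectangle_def)
    then obtain L where L: "latin_rectangle V L" "card L = card V"
      using latin_rectangle_complete[OF fin, of "{}"] by auto
    have "card V * card F \<le> card V * (k * fact (card V - 1))"
      unfolding total[OF L, symmetric] upper[symmetric] using each[OF L(1)] by (intro sum_mono)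
    then show ?thesis using n by simp
  qed
  show "card (F \<inter> L) = k"
    if eq: "card F = k * fact (card V - 1)" and L: "latin_rectangle V L" "card L = card V"
  proof (rule ccontr)
    \<comment> \<open>\<open>L\<close> is its own translate by \<open>id\<close>; a deficit there
      makes the sum over all translates too small.\<close>
    assume "card (F \<inter> L) \<noteq> k"
    then have "card (F \<inter> (\<circ>) id ` L) < k" using bound[OF L(1)] by simp
    then have "(\<Sum>g\<in>?S. card (F \<inter> (\<circ>) g ` L)) < (\<Sum>g\<in>?S. k)"
      using each[OF L(1)] permutes_id by (intro sum_strict_mono_ex1 finS) blast+
    then show False unfolding total[OF L] upper eq by simp
  qed
qed

text \<open>Permutations of \<open>T\<close> are products of transpositions. Invariance is asked
  only at the points \<open>g \<circ> p\<close>, so it may come from facts about permutations of a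
  larger set.\<close>

lemma permutes_transpose_invariant:
  assumes "finite T" "\<pi> permutes T"
    and "\<And>p a b. \<lbrakk>p permutes T; a \<in> T; b \<in> T; a \<noteq> b\<rbrakk> \<Longrightarrow> u (g \<circ> p \<circ> transpose a b) = u (g \<circ> p)"
  shows "u (g \<circ> \<pi>) = u g"
  using assms(1,2)
proof (induction rule: permutes_rev_induct)
  case id
  show ?case by simp
next
  case (swap a b p)
  then show ?case using assms(3)[of p a b] by (metis comp_assoc)
qed

subsection \<open>Trades between two rows of a Latin square\<close>

text \<open>The extremal family enters through its indicator \<open>f\<close>; integer values allow
  differences without truncation.\<close>

locale constant_on_latin =
  fixes V :: "'a set" and f :: "('a \<Rightarrow> 'a) \<Rightarrow> int" and k :: int
  assumes fin: "finite V"
    and latin_sum: "\<lbrakk>latin_rectangle V L; card L = card V\<rbrakk> \<Longrightarrow> (\<Sum>p\<in>L. f p) = k"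
begin

text \<open>The two pairs of rows occupy the same cells, so either pair can be completed to a Latin
  square by the same remaining rows.\<close>

lemma two_row_trade:
  assumes g: "g permutes V" and A: "A \<subset> V" "A \<noteq> {}"
    and \<alpha>: "\<alpha> permutes A" "\<And>x. x \<in> A \<Longrightarrow> \<alpha> x \<noteq> x"
    and \<beta>: "\<beta> permutes V - A" "\<And>x. x \<in> V - A \<Longrightarrow> \<beta> x \<noteq> x"
  shows "f g + f (g \<circ> \<alpha> \<circ> \<beta>) = f (g \<circ> \<alpha>) + f (g \<circ> \<beta>)"
proof -
  define q where "q = g \<circ> \<alpha> \<circ> \<beta>"
  define p' where "p' = g \<circ> \<alpha>"
  define q' where "q' = g \<circ> \<beta>"
  have \<alpha>V: "\<alpha> permutes V" and \<beta>V: "\<beta> permutes V"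
    using \<alpha>(1) \<beta>(1) A by (auto intro: permutes_subset)
  have perm: "q permutes V" "p' permutes V" "q' permutes V"
    unfolding q_def p'_def q'_def using g \<alpha>V \<beta>V by (auto intro!: permutes_compose)
  \<comment> \<open>On \<open>A\<close> the rows \<open>p'\<close>, \<open>q'\<close> hold the
    values of \<open>q\<close>, \<open>g\<close>, off \<open>A\<close> those of \<open>g\<close>,
    \<open>q\<close>. So each column contains the same two values before and after the
    trade.\<close>
  have on_A: "q x = p' x" "q' x = g x" if "x \<in> A" for x
    using permutes_not_in[OF \<beta>(1), of x] that by (auto simp: q_def p'_def q'_def)
  have off_A: "q x = q' x" "p' x = g x" if "x \<in> V - A" for x
  proof -
    have "\<beta> x \<in> V - A" using that permutes_in_image[OF \<beta>(1)] by blast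
    then show "q x = q' x" "p' x = g x"
      using permutes_not_in[OF \<alpha>(1)] that by (auto simp: q_def p'_def q'_def)
  qed
  have injg: "inj g" using g by (rule permutes_inj)
  have "p' x \<noteq> g x" if "x \<in> A" for x
    using \<alpha>(2)[OF that] injg by (auto simp: p'_def inj_eq)
  moreover have "q' x \<noteq> g x" if "x \<in> V - A" for x
    using \<beta>(2)[OF that] injg by (auto simp: q'_def inj_eq)
  ultimately have gq: "g x \<noteq> q x" and pq': "p' x \<noteq> q' x" if "x \<in> V" for x
    using on_A[of x] off_A[of x] that by (metis DiffI)+
  have ne: "g \<noteq> q" "p' \<noteq> q'" using gq pq' A by auto
  have "card {g, q} \<le> card V"
  proof -
    obtain x y where "x \<in> A" "y \<in> V - A" using A by blast
    then have "card {x, y} \<le> card V" "x \<noteq> y" using A fin by (auto intro!: card_mono)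
    then show ?thesis using ne by simp
  qed
  then obtain M where M: "{g, q} \<subseteq> M" "latin_rectangle V M" "card M = card V"
    using latin_rectangle_complete[OF fin latin_rectangle_doubleton[OF g perm(1) gq]] by blast
  define R where "R = M - {g, q}"
  have R: "latin_rectangle V R"
    using M(2) unfolding R_def latin_rectangle_def by (auto intro: pairwise_subset)
  have disj: "r x \<noteq> g x" "r x \<noteq> q x" if "r \<in> R" "x \<in> V" for r x
    using M(1,2) that unfolding R_def latin_rectangle_def pairwise_def by auto
  have disj': "p' x \<noteq> r x" "q' x \<noteq> r x" if "r \<in> R" "x \<in> V" for r x
    using disj[OF that] on_A[of x] off_A[of x] that by (metis DiffI)+
  have L: "latin_rectangle V (insert p' (insert q' R))"
    using R perm disj' pq' by (intro latin_rectangle_insert) auto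
  obtain x where x: "x \<in> V" using A by blast
  have notin: "p' \<notin> insert q' R" "q' \<notin> R" using disj' x ne by blast+
  have finM: "finite M" using M(3) fin A by (metis card.infinite card_eq_0_iff psubset_imp_subset subset_empty)
  then have finR: "finite R" by (simp add: R_def)
  have MR: "M = insert g (insert q R)" "g \<notin> insert q R" "q \<notin> R"
    using M(1) ne by (auto simp: R_def)
  have "card (insert p' (insert q' R)) = card M" using MR notin finR by simp
  then have "(\<Sum>p\<in>insert p' (insert q' R). f p) = (\<Sum>p\<in>M. f p)"
    using latin_sum L M by simp
  then have "f g + f q = f p' + f q'" using MR notin finR by simp
  then show ?thesis by (simp add: q_def p'_def q'_def)
qed

text \<open>This is the trade on \<open>A = {a, b}\<close> with \<open>transpose a b\<close> as
  \<alpha>, rearranged: the effect of that transposition on \<open>f\<close> is not altered by a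
  derangement of all other points.\<close>

lemma transpose_difference_invariant:
  assumes g: "g permutes V" and ab: "a \<in> V" "b \<in> V" "a \<noteq> b" "V \<noteq> {a, b}"
    and \<beta>: "\<beta> permutes V - {a, b}" "\<And>x. x \<in> V - {a, b} \<Longrightarrow> \<beta> x \<noteq> x"
  shows "f (g \<circ> \<beta>) - f (g \<circ> \<beta> \<circ> transpose a b) = f g - f (g \<circ> transpose a b)"
proof -
  have "f g + f (g \<circ> transpose a b \<circ> \<beta>) = f (g \<circ> transpose a b) + f (g \<circ> \<beta>)"
    using assms by (intro two_row_trade[where A = "{a, b}"]) (auto intro: permutes_swap_id)
  moreover have "transpose a b \<circ> \<beta> = \<beta> \<circ> transpose a b"
  proof
    fix x
    have fixed: "\<beta> a = a" "\<beta> b = b" using permutes_not_in[OF \<beta>(1)] by auto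
    then have "\<beta> x = a \<longleftrightarrow> x = a" "\<beta> x = b \<longleftrightarrow> x = b"
      using permutes_inj[OF \<beta>(1)] by (metis injD)+
    then show "(transpose a b \<circ> \<beta>) x = (\<beta> \<circ> transpose a b) x"
      using fixed by (auto simp: transpose_def)
  qed
  ultimately show ?thesis by (simp add: comp_assoc)
qed

section \<open>Vanishing of mixed differences\<close>

text \<open>The second difference of \<open>f\<close> at \<open>g\<close> along two transpositions;
  its vanishing is the switching relation for disjoint ones.\<close>

definition mixed :: "'a \<Rightarrow> 'a \<Rightarrow> 'a \<Rightarrow> 'a \<Rightarrow> ('a \<Rightarrow> 'a) \<Rightarrow> int" where
  "mixed a b c d g = f g - f (g \<circ> transpose a b)
     - (f (g \<circ> transpose c d) - f (g \<circ> transpose c d \<circ> transpose a b))"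

text \<open>With at least four points outside \<open>{a, b}\<close>, the transposition of \<open>c\<close>
  and \<open>d\<close> is a quotient of two derangements of those points.\<close>

lemma mixed_eq_0_large:
  assumes card: "card V \<ge> 6" and g: "g permutes V"
    and V: "a \<in> V" "b \<in> V" "c \<in> V" "d \<in> V" and dist: "distinct [a, b, c, d]"
  shows "mixed a b c d g = 0"
proof -
  define B where "B = V - {a, b}"
  have cardB: "card B \<ge> 4" using card V dist fin by (simp add: B_def card_Diff_subset)
  have cd: "c \<in> B" "d \<in> B" using V dist by (auto simp: B_def)
  have "card (B - {c, d}) \<ge> 2" using cardB cd dist fin by (simp add: B_def card_Diff_subset)
  then obtain \<tau> where \<tau>: "\<tau> permutes B - {c, d}" "\<And>x. x \<in> B - {c, d} \<Longrightarrow> \<tau> x \<noteq> x"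
    using exists_derangement[of "B - {c, d}"] fin by (auto simp: B_def)
  \<comment> \<open>\<sigma> is a derangement of \<open>B\<close> that swaps \<open>c\<close> and
    \<open>d\<close>. A row \<beta> avoiding both \<open>id\<close> and \<sigma> is a derangement
    with \<open>\<beta> c \<noteq> d\<close> and \<open>\<beta> d \<noteq> c\<close>, which makes
    \<open>transpose c d \<circ> \<beta>\<close> a derangement as well.\<close>
  define \<sigma> where "\<sigma> = transpose c d \<circ> \<tau>"
  have \<tau>B: "\<tau> permutes B" using \<tau>(1) by (rule permutes_subset) auto
  have \<sigma>B: "\<sigma> permutes B"
    unfolding \<sigma>_def using \<tau>B cd by (intro permutes_compose permutes_swap_id)
  have \<sigma>cd: "\<sigma> c = d" "\<sigma> d = c" using permutes_not_in[OF \<tau>(1)] by (auto simp: \<sigma>_def)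
  have "\<sigma> x \<noteq> x" if "x \<in> B" for x
  proof (cases "x = c \<or> x = d")
    case False
    then have "\<tau> x \<in> B - {c, d}" using that permutes_in_image[OF \<tau>(1)] by blast
    then show ?thesis using False \<tau>(2) that by (simp add: \<sigma>_def transpose_def)
  qed (use \<sigma>cd dist in auto)
  then have "latin_rectangle B {id, \<sigma>}"
    using \<sigma>B by (intro latin_rectangle_doubleton) (auto simp: permutes_id, metis)
  moreover have "card {id, \<sigma>} < card B"
    using cardB by (simp add: card_insert_if)
  ultimately obtain \<beta> where \<beta>: "\<beta> permutes B" "\<And>x. x \<in> B \<Longrightarrow> \<beta> x \<noteq> x" "\<And>x. x \<in> B \<Longrightarrow> \<beta> x \<noteq> \<sigma> x"
    using latin_rectangle_extend_row[of B "{id, \<sigma>}"] fin by (auto simp: B_def)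
  define \<beta>' where "\<beta>' = transpose c d \<circ> \<beta>"
  have \<beta>'B: "\<beta>' permutes B"
    unfolding \<beta>'_def using \<beta>(1) cd by (intro permutes_compose permutes_swap_id)
  have \<beta>'der: "\<beta>' x \<noteq> x" if "x \<in> B" for x
    using \<beta>(2,3)[OF that] \<beta>(3)[OF cd(1)] \<beta>(3)[OF cd(2)] \<sigma>cd
    by (auto simp: \<beta>'_def transpose_def split: if_splits)
  have Vne: "V \<noteq> {a, b}" using V dist by auto
  have gcd: "g \<circ> transpose c d permutes V"
    using g V by (intro permutes_compose permutes_swap_id)
  \<comment> \<open>Derangements of \<open>B\<close> lead from \<open>g\<close> and from
    \<open>g \<circ> transpose c d\<close> to the same permutation, so both have its difference
    along \<open>transpose a b\<close>.\<close>
  have eq: "g \<circ> transpose c d \<circ> \<beta>' = g \<circ> \<beta>" by (simp add: \<beta>'_def fun_eq_iff)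
  show ?thesis
    using transpose_difference_invariant[OF g V(1,2) _ Vne, of \<beta>]
      transpose_difference_invariant[OF gcd V(1,2) _ Vne, of \<beta>'] dist \<beta> \<beta>'B \<beta>'der eq
    by (simp add: mixed_def B_def)
qed

text \<open>Only \<open>c\<close> and \<open>d\<close> lie outside \<open>{a, b}\<close>, so their
  transposition is itself a derangement there.\<close>

lemma mixed_eq_0_four:
  assumes card: "card V = 4" and g: "g permutes V"
    and V: "a \<in> V" "b \<in> V" "c \<in> V" "d \<in> V" and dist: "distinct [a, b, c, d]"
  shows "mixed a b c d g = 0"
proof -
  have "card {a, b, c, d} = card V" using dist card by simp
  then have "V = {a, b, c, d}" using V fin by (metis card_subset_eq empty_subsetI insert_subset)
  then have B: "V - {a, b} = {c, d}" "V \<noteq> {a, b}" using dist by auto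
  show ?thesis
    using transpose_difference_invariant[OF g V(1,2) _ B(2), of "transpose c d"] dist
    by (force simp: mixed_def B(1) permutes_swap_id)
qed

lemma mixed_commute: "distinct [a, b, c, d] \<Longrightarrow> mixed a b c d g = mixed c d a b g"
proof -
  assume "distinct [a, b, c, d]"
  then have "transpose a b \<circ> transpose c d = transpose c d \<circ> transpose a b"
    by (auto simp: fun_eq_iff transpose_def)
  then show ?thesis by (simp add: mixed_def comp_assoc)
qed

lemma mixed_swap: "mixed a b c d g = mixed b a c d g" "mixed a b c d g = mixed a b d c g"
  by (simp_all add: mixed_def transpose_commute)

lemma mixed_transpose: "mixed a b c d (g \<circ> transpose c d) = - mixed a b c d g"
  by (simp add: mixed_def comp_assoc)

text \<open>Here trades alone do not suffice: derangements of three points are even, so the sign function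
  satisfies all trade relations. They do force the mixed difference to be constant up to sign, and
  a sum of five such values over a Latin square, which is zero, forces that constant to vanish.\<close>

lemma mixed_eq_0_five:
  assumes card: "card V = 5" and g: "g permutes V"
    and V: "a \<in> V" "b \<in> V" "c \<in> V" "d \<in> V" and dist: "distinct [a, b, c, d]"
  shows "mixed a b c d g = 0"
proof -
  have shift: "mixed a b c d h = mixed a b c e h"
    if h: "h permutes V" and V': "a \<in> V" "b \<in> V" "c \<in> V" "d \<in> V" "e \<in> V"
      and dist': "distinct [a, b, c, d, e]" for a b c d e h
  proof -
    have "card {a, b, c, d, e} = card V" using dist' card by simp
    then have Veq: "V = {a, b, c, d, e}"
      using V' fin by (metis card_subset_eq empty_subsetI insert_subset)
    \<comment> \<open>The quotient of \<open>transpose c d\<close> and \<open>transpose c e\<close>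
      is a 3-cycle, hence a derangement of \<open>c\<close>, \<open>d\<close>,
      \<open>e\<close>.\<close>
    define \<beta> where "\<beta> = transpose c d \<circ> transpose c e"
    have B: "V - {a, b} = {c, d, e}" "V \<noteq> {a, b}" using dist' Veq by auto
    have \<beta>: "\<beta> permutes V - {a, b}" "\<And>x. x \<in> V - {a, b} \<Longrightarrow> \<beta> x \<noteq> x"
      unfolding B(1) \<beta>_def using dist'
      by (auto simp: transpose_def intro!: permutes_compose permutes_swap_id)
    have hcd: "h \<circ> transpose c d permutes V"
      using h V' by (intro permutes_compose permutes_swap_id)
    have eq: "h \<circ> transpose c d \<circ> \<beta> = h \<circ> transpose c e" by (simp add: \<beta>_def fun_eq_iff)
    show ?thesis
      using transpose_difference_invariant[OF hcd V'(1,2) _ B(2) \<beta>] dist' eq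
      by (simp add: mixed_def)
  qed
  have "card (V - {a, b, c, d}) = 1"
    using V dist card fin by (simp add: card_Diff_subset)
  then obtain e where e: "V - {a, b, c, d} = {e}" by (auto simp: card_1_singleton_iff)
  then have eV: "e \<in> V" "distinct [a, b, c, d, e]" and Veq: "V = {a, b, c, d, e}"
    using V dist by auto
  \<comment> \<open>The symmetries of \<open>mixed\<close> and \<open>shift\<close> bring any two
    points into the last two slots without changing the value. The ten pairs of the five points are
    treated one by one.\<close>
  have move: "\<exists>z w. \<forall>h. h permutes V \<longrightarrow> mixed a b c d h = mixed z w x y h"
    if xy: "x \<in> V" "y \<in> V" "x \<noteq> y" for x y
  proof -
    define P where "P = (\<lambda>x y. \<exists>z w. \<forall>h. h permutes V \<longrightarrow> mixed a b c d h = mixed z w x y h)"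
    have sym: "P y x" if "P x y" for x y
      using that unfolding P_def by (metis mixed_swap(2))
    have outer: "mixed p q r s h = mixed r s p t h"
      if "h permutes V" "{p, q, r, s, t} \<subseteq> V" "distinct [p, q, r, s, t]" for p q r s t h
      using shift[of h r s p q t] mixed_commute[of p q r s h] that by auto
    have cross: "mixed p q r s h = mixed s t p r h"
      if "h permutes V" "{p, q, r, s, t} \<subseteq> V" "distinct [p, q, r, s, t]" for p q r s t h
      using shift[of h p q s r t] outer[of h p q s t r] mixed_swap(2)[of p q r s h] that by auto
    have ins: "{a, b, c, d, e} \<subseteq> V" using V eV by auto
    have "P a b" using mixed_commute[OF dist] unfolding P_def by blast
    moreover have "P c d" unfolding P_def by blast
    moreover have "P a c" unfolding P_def using cross[of _ a b c d e] eV ins by blast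
    moreover have "P a d" unfolding P_def
      using cross[of _ a b d c e] mixed_swap(2)[of a b c d] eV ins by (intro exI[of _ c] exI[of _ e]) auto
    moreover have "P b c" unfolding P_def
      using cross[of _ b a c d e] mixed_swap(1)[of a b c d] eV ins by (intro exI[of _ d] exI[of _ e]) auto
    moreover have "P b d" unfolding P_def
      using cross[of _ b a d c e] mixed_swap[of a b c d] mixed_swap(2)[of b a c d] eV ins
      by (intro exI[of _ c] exI[of _ e]) auto
    moreover have "P a e" unfolding P_def using outer[of _ a b c d e] eV ins by blast
    moreover have "P b e" unfolding P_def
      using outer[of _ b a c d e] mixed_swap(1)[of a b c d] eV ins by (intro exI[of _ c] exI[of _ d]) auto
    moreover have "P c e" unfolding P_def using shift[of _ a b c d e] eV V by blast
    moreover have "P d e" unfolding P_def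
      using shift[of _ a b d c e] mixed_swap(2)[of a b c d] eV V by (intro exI[of _ a] exI[of _ b]) auto
    ultimately have "P x y" using xy sym unfolding Veq by blast
    then show ?thesis by (simp add: P_def)
  qed
  \<comment> \<open>With \<open>x\<close>, \<open>y\<close> in the last two slots, composing with
    their transposition changes the sign, so the mixed difference alternates like the sign of a
    permutation.\<close>
  have flip: "mixed a b c d (h \<circ> transpose x y) = - mixed a b c d h"
    if h: "h permutes V" and xy: "x \<in> V" "y \<in> V" "x \<noteq> y" for x y h
  proof -
    have "h \<circ> transpose x y permutes V" using h xy by (intro permutes_compose permutes_swap_id)
    then show ?thesis using move[OF xy] h mixed_transpose by metis
  qed
  have abs_eq: "\<bar>mixed a b c d (g \<circ> \<pi>)\<bar> = \<bar>mixed a b c d g\<bar>" if "\<pi> permutes V" for \<pi>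
    using fin that
  proof (rule permutes_transpose_invariant)
    fix p x y assume "p permutes V" "x \<in> V" "y \<in> V" "x \<noteq> y"
    then show "\<bar>mixed a b c d (g \<circ> p \<circ> transpose x y)\<bar> = \<bar>mixed a b c d (g \<circ> p)\<bar>"
      using flip[of "g \<circ> p" x y] g by (simp add: permutes_compose)
  qed
  have abs_const: "\<bar>mixed a b c d h\<bar> = \<bar>mixed a b c d g\<bar>" if "h permutes V" for h
  proof -
    have "h = g \<circ> (inv g \<circ> h)" using g by (simp add: fun_eq_iff permutes_inverses)
    then show ?thesis using abs_eq[of "inv g \<circ> h"] g that by (metis permutes_compose permutes_inv)
  qed
  have "latin_rectangle V {}" by (simp add: latin_rectangle_def)
  then obtain M where M: "latin_rectangle V M" "card M = card V"
    using latin_rectangle_complete[OF fin, of "{}"] by auto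
  have Mp: "p permutes V" if "p \<in> M" for p using M(1) that by (auto simp: latin_rectangle_def)
  have translate: "(\<Sum>p\<in>M. f (p \<circ> \<tau>)) = k" if \<tau>: "\<tau> permutes V" for \<tau>
  proof -
    have inj: "inj_on (\<lambda>p. p \<circ> \<tau>) M"
    proof (rule inj_on_inverseI)
      show "p \<circ> \<tau> \<circ> inv \<tau> = p" for p
        using \<tau> by (simp add: comp_assoc permutes_inv_o)
    qed
    show ?thesis
      using latin_sum[OF latin_rectangle_translate_right[OF M(1) \<tau>]] M(2) inj
      by (simp add: card_image sum.reindex)
  qed
  have ab: "transpose a b permutes V" and cd: "transpose c d permutes V"
    and cdab: "transpose c d \<circ> transpose a b permutes V"
    using V by (auto intro!: permutes_swap_id permutes_compose)
  \<comment> \<open>Each of the four terms of \<open>mixed\<close> runs over a right translate of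
    \<open>M\<close>, which is again a Latin square, and so sums to \<open>k\<close>.\<close>
  have sum0: "(\<Sum>p\<in>M. mixed a b c d p) = 0"
    using translate[OF permutes_id] translate[OF ab] translate[OF cd] translate[OF cdab]
    by (simp add: mixed_def sum_subtractf comp_assoc)
  define m where "m = \<bar>mixed a b c d g\<bar>"
  show ?thesis
  proof (rule ccontr)
    assume "mixed a b c d g \<noteq> 0"
    then have m: "m \<noteq> 0" by (simp add: m_def)
    have absM: "\<bar>mixed a b c d p\<bar> = m" if "p \<in> M" for p
      unfolding m_def using abs_const Mp that by blast
    have "(\<Sum>p\<in>M. mixed a b c d p) = (\<Sum>p\<in>M. m * sgn (mixed a b c d p))"
      by (intro sum.cong) (auto simp: absM[symmetric] abs_mult_sgn)
    \<comment> \<open>Five signs, each 1 or -1, cannot sum to the even number 0.\<close>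
    then have "(\<Sum>p\<in>M. sgn (mixed a b c d p)) = 0"
      using sum0 m by (simp flip: sum_distrib_left)
    moreover have "{p \<in> M. odd (sgn (mixed a b c d p))} = M"
      using absM m by (force simp: sgn_if)
    moreover have "finite M" using M(2) card by (intro card_ge_0_finite) simp
    ultimately show False
      using even_sum_iff[of M "\<lambda>p. sgn (mixed a b c d p)"] M(2) card by simp
  qed
qed

lemma mixed_eq_0:
  assumes "card V \<ge> 4" "g permutes V" "a \<in> V" "b \<in> V" "c \<in> V" "d \<in> V" "distinct [a, b, c, d]"
  shows "mixed a b c d g = 0"
proof -
  consider "card V = 4" | "card V = 5" | "card V \<ge> 6" using assms(1) by linarith
  then show ?thesis
    using assms mixed_eq_0_four mixed_eq_0_five mixed_eq_0_large by cases auto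
qed

end

lemma permutation_extending:
  assumes "finite V" "A \<subseteq> V" "inj_on r A" "r ` A \<subseteq> V"
  shows "\<exists>g. g permutes V \<and> (\<forall>x\<in>A. g x = r x)"
proof -
  have fin: "finite A" "finite (r ` A)" using assms finite_subset by auto
  have "card (V - A) = card (V - r ` A)"
    using assms fin by (simp add: card_Diff_subset card_image)
  then obtain t where t: "bij_betw t (V - A) (V - r ` A)"
    using assms(1) by (meson finite_Diff finite_same_card_bij)
  define g where "g = (\<lambda>x. if x \<in> A then r x else if x \<in> V then t x else x)"
  have "bij_betw g A (r ` A)"
    using assms(3) by (auto simp: bij_betw_def g_def inj_on_def)
  moreover have "bij_betw g (V - A) (V - r ` A)"
    using t by (rule bij_betw_cong[THEN iffD1, rotated]) (auto simp: g_def)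
  ultimately have "bij_betw g (A \<union> (V - A)) (r ` A \<union> (V - r ` A))"
    by (rule bij_betw_combine) auto
  moreover have "A \<union> (V - A) = V" "r ` A \<union> (V - r ` A) = V" using assms by auto
  ultimately have "g permutes V"
    using assms(2) by (intro bij_imp_permutes) (auto simp: g_def)
  then show ?thesis by (intro exI[of _ g]) (simp add: g_def)
qed

subsection \<open>Cross-intersecting complete multipartite graphs\<close>

text \<open>The third clause is transitivity of non-adjacency in contrapositive form: non-adjacency
  is an equivalence relation whose classes are the parts. Edgeless graphs are included.\<close>

definition complete_multipartite :: "'a set \<Rightarrow> ('a \<Rightarrow> 'a \<Rightarrow> bool) \<Rightarrow> bool" where
  "complete_multipartite V R \<longleftrightarrow>
     (\<forall>x\<in>V. \<not> R x x) \<and> (\<forall>x\<in>V. \<forall>y\<in>V. R x y \<longrightarrow> R y x) \<and>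
     (\<forall>x\<in>V. \<forall>y\<in>V. \<forall>z\<in>V. R x y \<longrightarrow> R x z \<or> R z y)"

definition star_at :: "'a set \<Rightarrow> ('a \<Rightarrow> 'a \<Rightarrow> bool) \<Rightarrow> 'a \<Rightarrow> bool" where
  "star_at V R j \<longleftrightarrow> j \<in> V \<and> (\<forall>x\<in>V. \<forall>y\<in>V. R x y \<longleftrightarrow> x \<noteq> y \<and> (x = j \<or> y = j))"

lemma exists_fourth:
  assumes "card V \<ge> 4"
  shows "\<exists>v. v \<in> V \<and> v \<notin> {a, b, c}"
proof -
  have "card {a, b, c} \<le> 3" by (simp add: card_insert_if)
  then have "\<not> V \<subseteq> {a, b, c}" using assms card_mono[of "{a, b, c}" V] by auto
  then show ?thesis by auto
qed

text \<open>An edge from a further point \<open>w\<close> to \<open>y\<close> would miss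
  \<open>x z\<close>, so transitivity of non-adjacency makes \<open>w\<close> adjacent to
  \<open>x\<close>. An edge avoiding \<open>x\<close> would then have to meet three edges at
  \<open>x\<close>, but it has only two ends.\<close>

lemma star_atI:
  assumes V: "card V \<ge> 4" and R: "complete_multipartite V R"
    and edges: "R x y" "R x z" "x \<in> V" "y \<in> V" "z \<in> V" "y \<noteq> z"
    and meet: "\<And>p q r s. \<lbrakk>R p q; R r s; p \<in> V; q \<in> V; r \<in> V; s \<in> V\<rbrakk>
      \<Longrightarrow> p = r \<or> p = s \<or> q = r \<or> q = s"
  shows "star_at V R x"
proof -
  have irr: "\<not> R u u" if "u \<in> V" for u
    using R that by (auto simp: complete_multipartite_def)
  have sym: "R u v \<Longrightarrow> R v u" if "u \<in> V" "v \<in> V" for u v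
    using R that by (auto simp: complete_multipartite_def)
  have tri: "R u v \<Longrightarrow> R u w \<or> R w v" if "u \<in> V" "v \<in> V" "w \<in> V" for u v w
    using R that unfolding complete_multipartite_def by blast
  have xyz: "x \<noteq> y" "x \<noteq> z" using irr edges by auto
  have all: "R x w" if w: "w \<in> V" "w \<noteq> x" for w
  proof (cases "w = y \<or> w = z")
    case False
    then have "\<not> R w y" using meet[of w y x z] edges w xyz by auto
    then show ?thesis using tri[of x y w] edges w by auto
  qed (use edges in auto)
  obtain w where w: "w \<in> V" "w \<notin> {x, y, z}"
    using exists_fourth[OF V, of x y z] by blast
  have off: "\<not> R u v" if uv: "u \<in> V" "v \<in> V" "u \<noteq> x" "v \<noteq> x" for u v
  proof
    assume "R u v"
    then have "y = u \<or> y = v" "z = u \<or> z = v" "w = u \<or> w = v"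
      using meet[of x y u v] meet[of x z u v] meet[of x w u v] edges uv all w by auto
    then show False using edges w by auto
  qed
  show ?thesis
    unfolding star_at_def using edges(3) all off irr sym by metis
qed

text \<open>Any third point is adjacent to \<open>x\<close> or to \<open>y\<close>, which supplies
  two edges at one vertex.\<close>

lemma intersecting_complete_multipartite_star:
  assumes V: "card V \<ge> 4" and R: "complete_multipartite V R"
    and edge: "x \<in> V" "y \<in> V" "R x y"
    and meet: "\<And>p q r s. \<lbrakk>R p q; R r s; p \<in> V; q \<in> V; r \<in> V; s \<in> V\<rbrakk>
      \<Longrightarrow> p = r \<or> p = s \<or> q = r \<or> q = s"
  shows "\<exists>j. star_at V R j"
proof -
  have xy: "x \<noteq> y" "R y x" using R edge unfolding complete_multipartite_def by auto
  obtain z where z: "z \<in> V" "z \<notin> {x, y}"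
    using exists_fourth[OF V, of x y y] by blast
  have "R x z \<or> R y z"
    using R edge z unfolding complete_multipartite_def by blast
  then show ?thesis
  proof
    assume "R x z"
    then have "star_at V R x" using edge z by (intro star_atI[OF V R edge(3)]) (blast | rule meet)+
    then show ?thesis ..
  next
    assume "R y z"
    then have "star_at V R y" using edge z xy by (intro star_atI[OF V R xy(2)]) (blast | rule meet)+
    then show ?thesis ..
  qed
qed

lemma star_at_unique:
  assumes "card V \<ge> 4" "star_at V R j" "star_at V R k"
  shows "j = k"
proof (rule ccontr)
  assume "j \<noteq> k"
  moreover from this obtain v where "v \<in> V" "v \<notin> {j, k}"
    using exists_fourth[OF assms(1), of j k k] by blast
  ultimately show False using assms unfolding star_at_def by blast
qed

text \<open>Let \<open>R\<close> have disjoint edges \<open>a b\<close> and \<open>c d\<close>. An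
  edge of \<open>R'\<close> meets both, say it is \<open>a c\<close>; as \<open>R'\<close> contains
  neither \<open>a b\<close> nor \<open>c d\<close>, it also contains \<open>a d\<close> and
  \<open>b d\<close>. But \<open>R\<close> contains \<open>a c\<close> or \<open>c b\<close>, and
  these miss \<open>b d\<close> and \<open>a d\<close> respectively.\<close>

lemma cross_intersecting_no_disjoint_edges:
  assumes R: "complete_multipartite V R" "complete_multipartite V R'"
    and edge: "x' \<in> V" "y' \<in> V" "R' x' y'"
    and meet: "\<And>p q r s. \<lbrakk>R p q; R' r s; p \<in> V; q \<in> V; r \<in> V; s \<in> V\<rbrakk>
      \<Longrightarrow> p = r \<or> p = s \<or> q = r \<or> q = s"
    and V: "x \<in> V" "y \<in> V" "z \<in> V" "w \<in> V" and Rxy: "R x y" and Rzw: "R z w"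
  shows "x = z \<or> x = w \<or> y = z \<or> y = w"
proof (rule ccontr)
  assume *: "\<not> ?thesis"
  have sym: "R u v \<Longrightarrow> R v u" "R' u v \<Longrightarrow> R' v u" if "u \<in> V" "v \<in> V" for u v
    using R that by (auto simp: complete_multipartite_def)
  have tri: "R u v \<Longrightarrow> R u w \<or> R w v" "R' u v \<Longrightarrow> R' u w \<or> R' w v"
    if "u \<in> V" "v \<in> V" "w \<in> V" for u v w
    using R that unfolding complete_multipartite_def by blast+
  have neq: "x \<noteq> y" "z \<noteq> w" using R(1) V Rxy Rzw by (auto simp: complete_multipartite_def)
  have key: False
    if abcd: "a \<in> V" "b \<in> V" "c \<in> V" "d \<in> V" "R a b" "R c d" "R' a c" "distinct [a, b, c, d]"
    for a b c d
  proof -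
    have "\<not> R' a b" using meet[of c d a b] abcd by auto
    then have bc: "R' b c" using tri(2)[of a c b] abcd by auto
    have "\<not> R' d c" using meet[of a b d c] abcd by auto
    then have ad: "R' a d" using tri(2)[of a c d] abcd by auto
    then have bd: "R' b d" using tri(2)[of a d b] abcd \<open>\<not> R' a b\<close> by auto
    have "R a c \<or> R c b" using tri(1)[of a b c] abcd by auto
    then show False using meet[of a c b d] meet[of c b a d] abcd ad bd by auto
  qed
  have "x = x' \<or> x = y' \<or> y = x' \<or> y = y'" "z = x' \<or> z = y' \<or> w = x' \<or> w = y'"
    using meet[OF Rxy edge(3)] meet[OF Rzw edge(3)] V edge by auto
  then have "R' x z \<or> R' x w \<or> R' y z \<or> R' y w"
    using * edge sym(2)[of x' y'] by auto
  moreover have rev: "R y x" "R w z" using sym(1) V Rxy Rzw by auto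
  moreover have "distinct [x, y, z, w]" using * neq by auto
  ultimately show False
    using key[OF V Rxy Rzw] key[OF V(1,2,4,3) Rxy rev(2)] key[OF V(2,1,3,4) rev(1) Rzw]
      key[OF V(2,1,4,3) rev] by auto
qed

text \<open>Each graph is intersecting, hence a star. With different centres, four points leave room
  for two disjoint edges, one from each star.\<close>

lemma cross_intersecting_stars:
  assumes V: "card V \<ge> 4" and R: "complete_multipartite V R" "complete_multipartite V R'"
    and edges: "x \<in> V" "y \<in> V" "R x y" "x' \<in> V" "y' \<in> V" "R' x' y'"
    and meet: "\<And>p q r s. \<lbrakk>R p q; R' r s; p \<in> V; q \<in> V; r \<in> V; s \<in> V\<rbrakk>
      \<Longrightarrow> p = r \<or> p = s \<or> q = r \<or> q = s"
  shows "\<exists>j. star_at V R j \<and> star_at V R' j"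
proof -
  obtain j where j: "star_at V R j"
    using intersecting_complete_multipartite_star[OF V R(1) edges(1-3)]
      cross_intersecting_no_disjoint_edges[OF R edges(4-6) meet] by blast
  obtain k where k: "star_at V R' k"
    using intersecting_complete_multipartite_star[OF V R(2) edges(4-6)]
      cross_intersecting_no_disjoint_edges[OF R(2,1) edges(1-3)] meet by metis
  have "j = k"
  proof (rule ccontr)
    assume ne: "j \<noteq> k"
    obtain v where v: "v \<in> V" "v \<notin> {j, k}"
      using exists_fourth[OF V, of j k k] by blast
    obtain w where w: "w \<in> V" "w \<notin> {j, k, v}"
      using exists_fourth[OF V, of j k v] by blast
    have "R j v" "R' k w" "j \<in> V" "k \<in> V" using j k v w by (auto simp: star_at_def)
    then show False using meet[of j v k w] v w ne by auto
  qed
  then show ?thesis using j k by blast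
qed

subsection \<open>Boolean functions with vanishing mixed differences\<close>

locale boolean_mixed_zero =
  fixes V :: "'a set" and f :: "('a \<Rightarrow> 'a) \<Rightarrow> int"
  assumes fin: "finite V" and card: "card V \<ge> 4"
    and boolean: "g permutes V \<Longrightarrow> f g \<in> {0, 1}"
    and mixed_zero: "\<lbrakk>g permutes V; a \<in> V; b \<in> V; c \<in> V; d \<in> V; distinct [a, b, c, d]\<rbrakk>
      \<Longrightarrow> f g - f (g \<circ> transpose a b) = f (g \<circ> transpose c d) - f (g \<circ> transpose c d \<circ> transpose a b)"
begin

section \<open>Differences along transpositions and their additivity\<close>

text \<open>Since mixed differences vanish, the choice of \<open>g\<close> is immaterial, see \<open>diff_eq\<close>;
  outside \<open>V\<close> the value is meaningless.\<close>

definition diff :: "'a \<Rightarrow> 'a \<Rightarrow> 'a \<Rightarrow> 'a \<Rightarrow> int" where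
  "diff a b x y = (if a = b \<or> x = y then 0 else
     let g = (SOME g. g permutes V \<and> g a = x \<and> g b = y) in f g - f (g \<circ> transpose a b))"

text \<open>Permutations with the same values at \<open>a\<close> and \<open>b\<close> differ by a
  permutation of the other positions, and each transposition there preserves the difference along
  \<open>transpose a b\<close>.\<close>

lemma diff_eq:
  assumes g: "g permutes V" and ab: "a \<in> V" "b \<in> V" "a \<noteq> b"
  shows "diff a b (g a) (g b) = f g - f (g \<circ> transpose a b)"
proof -
  define h where "h = (SOME h. h permutes V \<and> h a = g a \<and> h b = g b)"
  have "\<exists>h. h permutes V \<and> h a = g a \<and> h b = g b" using g by auto
  then have h: "h permutes V" "h a = g a" "h b = g b"
    unfolding h_def by (metis (mono_tags, lifting) someI_ex)+
  define \<pi> where "\<pi> = inv g \<circ> h"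
  have h_eq: "h = g \<circ> \<pi>" using g by (simp add: \<pi>_def fun_eq_iff permutes_inverses)
  have \<pi>: "\<pi> permutes V - {a, b}"
  proof (rule permutes_superset)
    show "\<pi> permutes V" unfolding \<pi>_def using g h by (intro permutes_compose permutes_inv)
    show "\<pi> x = x" if "x \<in> V - (V - {a, b})" for x
      using that h g by (auto simp: \<pi>_def permutes_inverses)
  qed
  define u where "u = (\<lambda>h. f h - f (h \<circ> transpose a b))"
  have "u (g \<circ> \<pi>) = u g"
  proof (rule permutes_transpose_invariant[OF _ \<pi>])
    fix p c d
    assume p: "p permutes V - {a, b}" "c \<in> V - {a, b}" "d \<in> V - {a, b}" "c \<noteq> d"
    then have "g \<circ> p permutes V"
      using g permutes_subset[OF p(1)] by (intro permutes_compose) auto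
    then show "u (g \<circ> p \<circ> transpose c d) = u (g \<circ> p)"
      unfolding u_def using mixed_zero[of "g \<circ> p" a b c d] ab p by auto
  qed (use fin in auto)
  moreover have "diff a b (g a) (g b) = u h"
    using ab g permutes_inj by (fastforce simp: diff_def u_def h_def Let_def inj_eq)
  ultimately show ?thesis by (simp add: h_eq u_def)
qed

lemma diff_same [simp]: "diff a a x y = 0" "diff a b x x = 0"
  by (simp_all add: diff_def)

lemma permutation_with_values:
  assumes "distinct as" "distinct xs" "length as = length xs" "set as \<subseteq> V" "set xs \<subseteq> V"
  obtains g where "g permutes V" "map g as = xs"
proof -
  define r where "r = (\<lambda>a. the (map_of (zip as xs) a))"
  have r: "map r as = xs"
    using assms by (intro nth_equalityI) (auto simp: r_def map_of_zip_nth)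
  have "inj_on r (set as)" using r assms by (metis distinct_map)
  moreover have "r ` set as \<subseteq> V" using r assms by (metis list.set_map)
  ultimately obtain g where "g permutes V" "\<forall>x\<in>set as. g x = r x"
    using permutation_extending[OF fin assms(4)] by blast
  then show ?thesis using that r by (metis map_cong)
qed

lemma diff_swap_values:
  assumes "a \<in> V" "b \<in> V" "x \<in> V" "y \<in> V"
  shows "diff a b y x = - diff a b x y"
proof (cases "a = b \<or> x = y")
  case False
  then obtain g where g: "g permutes V" "map g [a, b] = [x, y]"
    using permutation_with_values[of "[a, b]" "[x, y]"] assms by auto
  have "g \<circ> transpose a b permutes V" using g assms by (intro permutes_compose permutes_swap_id)
  then show ?thesis
    using diff_eq[of g a b] diff_eq[of "g \<circ> transpose a b" a b] g assms False
    by (simp add: comp_assoc)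
qed auto

lemma diff_swap_positions:
  assumes "a \<in> V" "b \<in> V" "x \<in> V" "y \<in> V"
  shows "diff b a x y = - diff a b x y"
proof (cases "a = b \<or> x = y")
  case False
  then obtain g where g: "g permutes V" "map g [a, b] = [x, y]"
    using permutation_with_values[of "[a, b]" "[x, y]"] assms by auto
  have "diff b a y x = diff a b x y"
    using diff_eq[of g a b] diff_eq[of g b a] g assms False by (auto simp: transpose_commute)
  then show ?thesis using diff_swap_values[of b a x y] assms by simp
qed auto

text \<open>This is where the values 0 and 1 enter. If both transpositions changed \<open>f\<close>
  at a common \<open>g\<close>, the vanishing mixed difference would force the value 2 or -1 after
  applying both.\<close>

lemma diff_clash:
  assumes V: "a \<in> V" "b \<in> V" "c \<in> V" "d \<in> V" "x \<in> V" "y \<in> V" "z \<in> V" "w \<in> V"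
    and dist: "distinct [a, b, c, d]" "distinct [x, y, z, w]"
  shows "diff a b x y = 0 \<or> diff c d z w = 0"
proof -
  obtain g where g: "g permutes V" "map g [a, b, c, d] = [x, y, z, w]"
    using permutation_with_values[OF dist] V by auto
  have perms: "g \<circ> transpose a b permutes V" "g \<circ> transpose c d permutes V"
    "g \<circ> transpose c d \<circ> transpose a b permutes V"
    using g V by (auto intro!: permutes_compose permutes_swap_id)
  show ?thesis
    using diff_eq[of g a b] diff_eq[of g c d] mixed_zero[OF g(1) V(1-4) dist(1)] g V dist
      boolean[OF g(1)] boolean[OF perms(1)] boolean[OF perms(2)] boolean[OF perms(3)]
    by auto
qed

text \<open>The right-hand side of the second identity, and both sides of the first, are the alternating
  sum of \<open>f\<close> over the six arrangements of \<open>x, y, z\<close> on \<open>a, b, c\<close>.\<close>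

lemma hexagon:
  assumes V: "a \<in> V" "b \<in> V" "c \<in> V" "x \<in> V" "y \<in> V" "z \<in> V"
    and dist: "distinct [a, b, c]" "distinct [x, y, z]"
  shows "diff a b x y + diff a b y z + diff a b z x = diff b c x y + diff b c y z + diff b c z x"
    and "diff a b x y + diff b c x y + diff c a x y = diff a b x y + diff a b y z + diff a b z x"
proof -
  obtain g where g: "g permutes V" "map g [a, b, c] = [x, y, z]"
    using permutation_with_values[OF dist] V by auto
  \<comment> \<open>\<open>g\<close>, \<open>g1\<close>, \<open>g2\<close> are the three cyclic
    arrangements of \<open>x, y, z\<close>; a transposition of positions leads to the other
    three.\<close>
  define g1 where "g1 = g \<circ> transpose a b \<circ> transpose b c"
  define g2 where "g2 = g \<circ> transpose b c \<circ> transpose a b"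
  have perms: "g1 permutes V" "g2 permutes V"
    unfolding g1_def g2_def using g V by (auto intro!: permutes_compose permutes_swap_id)
  have vals: "g a = x" "g b = y" "g c = z" "g1 a = y" "g1 b = z" "g1 c = x"
    "g2 a = z" "g2 b = x" "g2 c = y"
    using g dist by (auto simp: g1_def g2_def transpose_def)
  have eqs: "g2 \<circ> transpose a b = g \<circ> transpose b c" "g1 \<circ> transpose b c = g \<circ> transpose a b"
    "g2 \<circ> transpose b c = g1 \<circ> transpose a b" "g1 \<circ> transpose c a = g \<circ> transpose b c"
    using dist by (auto simp: g1_def g2_def fun_eq_iff transpose_def)
  note facts = diff_eq[OF g(1), of a b] diff_eq[OF g(1), of b c] diff_eq[OF perms(1), of a b]
    diff_eq[OF perms(1), of b c] diff_eq[OF perms(2), of a b] diff_eq[OF perms(2), of b c]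
    diff_eq[OF perms(1), of c a]
  show "diff a b x y + diff a b y z + diff a b z x = diff b c x y + diff b c y z + diff b c z x"
    using facts eqs vals V dist by simp
  show "diff a b x y + diff b c x y + diff c a x y = diff a b x y + diff a b y z + diff a b z x"
    using facts eqs vals V dist by auto
qed

text \<open>Passing through a fourth position shows that the alternating sum \<open>H a b\<close> equals
  \<open>H b c\<close> and \<open>H c b = - H b c\<close>.\<close>

lemma diff_cycle_values:
  assumes V: "a \<in> V" "b \<in> V" "x \<in> V" "y \<in> V" "z \<in> V"
    and dist: "a \<noteq> b" "distinct [x, y, z]"
  shows "diff a b x y + diff a b y z + diff a b z x = 0"
proof -
  define H where "H = (\<lambda>a b. diff a b x y + diff a b y z + diff a b z x)"
  obtain c where c: "c \<in> V" "c \<notin> {a, b}" using exists_fourth[OF card, of a b b] by blast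
  obtain d where d: "d \<in> V" "d \<notin> {a, b, c}"
    using exists_fourth[OF card, of a b c] by blast
  have step: "H p q = H q r" if "p \<in> V" "q \<in> V" "r \<in> V" "distinct [p, q, r]" for p q r
    unfolding H_def using hexagon(1)[of p q r x y z] that V dist by auto
  have "H a b = H b d" by (rule step) (use V c d dist in auto)
  moreover have "H b d = H d c" by (rule step) (use V c d dist in auto)
  moreover have "H d c = H c b" by (rule step) (use V c d dist in auto)
  moreover have "H a b = H b c" by (rule step) (use V c d dist in auto)
  moreover have "H c b = - H b c"
    unfolding H_def using diff_swap_positions[OF V(2) c(1)] V by simp
  ultimately have "H a b = 0" by linarith
  then show ?thesis by (simp add: H_def)
qed

lemma diff_add_values:
  assumes V: "a \<in> V" "b \<in> V" "x \<in> V" "y \<in> V" "z \<in> V"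
  shows "diff a b x y = diff a b x z + diff a b z y"
proof (cases "a = b \<or> \<not> distinct [x, y, z]")
  case True
  then show ?thesis using diff_swap_values[OF V(1,2,5,3)] by auto
next
  case False
  then have "diff a b x y + diff a b y z + diff a b z x = 0"
    using V by (intro diff_cycle_values) auto
  then show ?thesis
    using diff_swap_values[OF V(1,2,4,5)] diff_swap_values[OF V(1,2,5,3)] by linarith
qed

text \<open>The second hexagon identity turns the cyclic sum over positions into one over values,
  which vanishes; \<open>z\<close> is an auxiliary third value.\<close>

lemma diff_add_positions:
  assumes V: "a \<in> V" "b \<in> V" "c \<in> V" "x \<in> V" "y \<in> V"
  shows "diff a b x y = diff a c x y + diff c b x y"
proof (cases "x = y \<or> \<not> distinct [a, b, c]")
  case True
  then show ?thesis using diff_swap_positions[OF V(3,1,4,5)] by auto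
next
  case False
  then obtain z where z: "z \<in> V" "z \<notin> {x, y}"
    using exists_fourth[OF card, of x y y] by blast
  then have "diff a b x y + diff b c x y + diff c a x y = 0"
    using hexagon(2)[of a b c x y z] diff_cycle_values[of a b x y z] V False by auto
  then show ?thesis
    using diff_swap_positions[OF V(2,3,4,5)] diff_swap_positions[OF V(3,1,4,5)] by linarith
qed

section \<open>Graphs of nonzero differences\<close>

abbreviation value_graph :: "'a \<Rightarrow> 'a \<Rightarrow> 'a \<Rightarrow> 'a \<Rightarrow> bool" where
  "value_graph a b \<equiv> (\<lambda>x y. diff a b x y \<noteq> 0)"

definition position_graph :: "'a \<Rightarrow> 'a \<Rightarrow> bool" where
  "position_graph a b \<longleftrightarrow> (\<exists>x\<in>V. \<exists>y\<in>V. diff a b x y \<noteq> 0)"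

text \<open>If a sum of two differences is nonzero, one summand is; additivity in the values thus
  makes non-adjacency transitive.\<close>

lemma value_graph_multipartite:
  assumes "a \<in> V" "b \<in> V"
  shows "complete_multipartite V (value_graph a b)"
  unfolding complete_multipartite_def
proof (intro conjI ballI impI)
  show "value_graph a b y x" if "x \<in> V" "y \<in> V" "value_graph a b x y" for x y
    using that diff_swap_values[OF assms, of x y] by simp
  show "value_graph a b x z \<or> value_graph a b z y"
    if "x \<in> V" "y \<in> V" "z \<in> V" "value_graph a b x y" for x y z
    using that diff_add_values[OF assms, of x y z] by linarith
qed simp

lemma position_graph_multipartite: "complete_multipartite V position_graph"
  unfolding complete_multipartite_def
proof (intro conjI ballI impI)
  show "\<not> position_graph a a" for a by (simp add: position_graph_def)
  show "position_graph b a" if "a \<in> V" "b \<in> V" "position_graph a b" for a b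
    using that diff_swap_positions[of a b] by (force simp: position_graph_def)
  show "position_graph a c \<or> position_graph c b"
    if "a \<in> V" "b \<in> V" "c \<in> V" "position_graph a b" for a b c
    using that diff_add_positions[of a b c] unfolding position_graph_def
    by (metis add.right_neutral)
qed

text \<open>By \<open>diff_clash\<close> the two value graphs are cross-intersecting.\<close>

lemma disjoint_positions_same_star:
  assumes V: "a \<in> V" "b \<in> V" "c \<in> V" "d \<in> V" and dist: "distinct [a, b, c, d]"
    and N: "position_graph a b" "position_graph c d"
  obtains j where "star_at V (value_graph a b) j" "star_at V (value_graph c d) j"
proof -
  obtain x y where xy: "x \<in> V" "y \<in> V" "value_graph a b x y"
    using N(1) by (auto simp: position_graph_def)
  obtain z w where zw: "z \<in> V" "w \<in> V" "value_graph c d z w"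
    using N(2) by (auto simp: position_graph_def)
  have "\<exists>j. star_at V (value_graph a b) j \<and> star_at V (value_graph c d) j"
  proof (rule cross_intersecting_stars[OF card value_graph_multipartite[OF V(1,2)]
        value_graph_multipartite[OF V(3,4)] xy zw])
    fix p q r s
    assume *: "diff a b p q \<noteq> 0" "diff c d r s \<noteq> 0" "p \<in> V" "q \<in> V" "r \<in> V" "s \<in> V"
    then have "p \<noteq> q" "r \<noteq> s" by auto
    then show "p = r \<or> p = s \<or> q = r \<or> q = s"
      using diff_clash[of a b c d p q r s] V dist * by auto
  qed
  then show ?thesis using that by blast
qed

text \<open>Vanishing away from \<open>j\<close> passes from the pairs \<open>a b\<close>,
  \<open>c d\<close> to the pairs across. If \<open>b d\<close> is no edge, additivity along
  \<open>a, b, d, c\<close> gives zero. If \<open>a c\<close> and \<open>b d\<close> are both edges,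
  they share a star centre, which has to be \<open>j\<close>.\<close>

lemma diagonal_zero:
  assumes V: "a \<in> V" "b \<in> V" "c \<in> V" "d \<in> V" and dist: "distinct [a, b, c, d]"
    and j: "star_at V (value_graph a b) j" "star_at V (value_graph c d) j"
    and xy: "x \<in> V" "y \<in> V" "x \<noteq> j" "y \<noteq> j"
  shows "diff a c x y = 0"
proof (cases "position_graph b d \<and> position_graph a c")
  case False
  then consider "\<not> position_graph b d" | "\<not> position_graph a c" by blast
  then show ?thesis
  proof cases
    case 1
    have "diff a c x y = diff a b x y + (diff b d x y + diff d c x y)"
      using diff_add_positions V xy by metis
    moreover have "diff a b x y = 0" using j(1) xy unfolding star_at_def by metis
    moreover have "diff c d x y = 0" using j(2) xy unfolding star_at_def by metis
    moreover have "diff b d x y = 0" using 1 xy by (auto simp: position_graph_def)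
    ultimately show ?thesis using diff_swap_positions[of c d x y] V xy by simp
  qed (use xy in \<open>auto simp: position_graph_def\<close>)
next
  case True
  have "distinct [a, c, b, d]" using dist by auto
  from disjoint_positions_same_star[OF V(1,3,2,4) this]
  obtain k where k: "star_at V (value_graph a c) k" "star_at V (value_graph b d) k"
    using True by blast
  have "k = j"
  proof (rule ccontr)
    assume ne: "k \<noteq> j"
    obtain v where v: "v \<in> V" "v \<notin> {j, k}"
      using exists_fourth[OF card, of j k k] by blast
    obtain w where w: "w \<in> V" "w \<notin> {j, k, v}"
      using exists_fourth[OF card, of j k v] by blast
    have jk: "j \<in> V" "k \<in> V" using j k by (auto simp: star_at_def)
    \<comment> \<open>Adding differences puts the value edge \<open>j v\<close> on the positions
      \<open>a d\<close> and the disjoint edge \<open>k w\<close> on \<open>b c\<close>, which is a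
      clash.\<close>
    have "diff a b j v \<noteq> 0" "diff a b k w = 0" "diff b d j v = 0" "diff a c k w \<noteq> 0"
      using j k jk v w ne unfolding star_at_def by (metis insertCI)+
    then have "diff a d j v \<noteq> 0" "diff b c k w \<noteq> 0"
      using diff_add_positions[of a d b j v] diff_add_positions[of b c a k w]
        diff_swap_positions[of a b k w] V jk v w by auto
    then show False
      using diff_clash[of a d b c j v k w] V dist jk v w ne by auto
  qed
  then show ?thesis using k(1) xy unfolding star_at_def by metis
qed

text \<open>Without disjoint edges the position graph is empty or a star, whose centre is
  \<open>i\<close>. Two disjoint edges instead fix a common star centre \<open>j\<close> among the
  values.\<close>

lemma diff_concentrated:
  "(\<exists>i\<in>V. \<forall>a\<in>V. \<forall>b\<in>V. a \<noteq> i \<longrightarrow> b \<noteq> i \<longrightarrow> (\<forall>x\<in>V. \<forall>y\<in>V. diff a b x y = 0)) \<or>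
   (\<exists>j\<in>V. \<forall>a\<in>V. \<forall>b\<in>V. \<forall>x\<in>V. \<forall>y\<in>V. x \<noteq> j \<longrightarrow> y \<noteq> j \<longrightarrow> diff a b x y = 0)"
proof (cases "\<exists>a\<in>V. \<exists>b\<in>V. \<exists>c\<in>V. \<exists>d\<in>V. distinct [a, b, c, d] \<and> position_graph a b \<and> position_graph c d")
  case False
  have irr: "\<not> position_graph a a" for a by (simp add: position_graph_def)
  show ?thesis
  proof (cases "\<exists>a\<in>V. \<exists>b\<in>V. position_graph a b")
    case True
    then obtain a b where ab: "a \<in> V" "b \<in> V" "position_graph a b" by blast
    have "\<exists>i. star_at V position_graph i"
    proof (rule intersecting_complete_multipartite_star[OF card position_graph_multipartite ab])
      fix p q r s
      assume "position_graph p q" "position_graph r s" "p \<in> V" "q \<in> V" "r \<in> V" "s \<in> V"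
      then show "p = r \<or> p = s \<or> q = r \<or> q = s" using False irr by (metis distinct_length_2_or_more distinct_singleton)
    qed
    then obtain i where "star_at V position_graph i" by blast
    then show ?thesis unfolding star_at_def position_graph_def by metis
  next
    case no_edges: False
    obtain i where "i \<in> V" using exists_fourth[OF card] by blast
    then show ?thesis using no_edges unfolding position_graph_def by blast
  qed
next
  case True
  then obtain a b c d where V: "a \<in> V" "b \<in> V" "c \<in> V" "d \<in> V"
    and dist: "distinct [a, b, c, d]" and N: "position_graph a b" "position_graph c d"
    by blast
  obtain j where j: "star_at V (value_graph a b) j" "star_at V (value_graph c d) j"
    using disjoint_positions_same_star[OF V dist N] .
  have swapped: "star_at V (value_graph q p) j" if "star_at V (value_graph p q) j" "p \<in> V" "q \<in> V" for p q
    using that diff_swap_positions[of p q] unfolding star_at_def by simp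
  have off: "diff p q x y = 0" if pq: "p \<in> V" "q \<in> V" and xy: "x \<in> V" "y \<in> V" "x \<noteq> j" "y \<noteq> j" for p q x y
  proof (rule ccontr)
    assume ne: "diff p q x y \<noteq> 0"
    then have pqN: "position_graph p q" "p \<noteq> q" using xy by (auto simp: position_graph_def)
    have star: "\<not> star_at V (value_graph p q) j" using ne xy unfolding star_at_def by metis
    \<comment> \<open>A position edge disjoint from \<open>p q\<close> with star centre
      \<open>j\<close> would force that centre on \<open>p q\<close>. So \<open>p q\<close> meets
      both \<open>a b\<close> and \<open>c d\<close>, hence joins one to the other, and
      \<open>diagonal_zero\<close> applies.\<close>
    have meets: "{p, q} \<inter> {r, s} \<noteq> {}"
      if "r \<in> V" "s \<in> V" "r \<noteq> s" "position_graph r s" "star_at V (value_graph r s) j" for r s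
    proof
      assume "{p, q} \<inter> {r, s} = {}"
      then have "distinct [p, q, r, s]" using that pqN by auto
      from disjoint_positions_same_star[OF pq that(1,2) this pqN(1) that(4)]
      obtain l where "star_at V (value_graph p q) l" "star_at V (value_graph r s) l" .
      then show False using star star_at_unique[of V _ l j] that card by auto
    qed
    have "{p, q} \<inter> {a, b} \<noteq> {}" "{p, q} \<inter> {c, d} \<noteq> {}"
      using meets V dist N j by auto
    moreover have "diff r s x y = 0" if "r \<in> {a, b}" "s \<in> {c, d}" for r s
      using diagonal_zero[of a b c d j x y] diagonal_zero[of a b d c j x y]
        diagonal_zero[of b a c d j x y] diagonal_zero[of b a d c j x y]
        V dist j swapped that xy by auto
    ultimately show False
      using ne diff_swap_positions[of p q x y] pq xy dist by auto
  qed
  moreover have "j \<in> V" using j(1) by (simp add: star_at_def)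
  ultimately show ?thesis by blast
qed

text \<open>Permutations agreeing at \<open>i\<close> differ by transpositions of other positions,
  and these have difference zero.\<close>

lemma dictator:
  "(\<exists>i\<in>V. \<forall>g h. g permutes V \<longrightarrow> h permutes V \<longrightarrow> g i = h i \<longrightarrow> f g = f h) \<or>
   (\<exists>j\<in>V. \<forall>g h. g permutes V \<longrightarrow> h permutes V \<longrightarrow> inv g j = inv h j \<longrightarrow> f g = f h)"
proof -
  have move: "f g = f h"
    if gh: "g permutes V" "h permutes V" "g i = h i"
      and zero: "\<And>a b g'. \<lbrakk>a \<in> V - {i}; b \<in> V - {i}; g' permutes V; g' i = g i\<rbrakk>
        \<Longrightarrow> diff a b (g' a) (g' b) = 0" for g h i
  proof -
    define \<pi> where "\<pi> = inv g \<circ> h"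
    have h_eq: "h = g \<circ> \<pi>" using gh by (simp add: \<pi>_def fun_eq_iff permutes_inverses)
    have \<pi>: "\<pi> permutes V - {i}"
    proof (rule permutes_superset)
      show "\<pi> permutes V" unfolding \<pi>_def using gh by (intro permutes_compose permutes_inv)
      show "\<pi> x = x" if "x \<in> V - (V - {i})" for x
        using that gh(3)[symmetric] gh(1) by (auto simp: \<pi>_def permutes_inverses)
    qed
    have "f (g \<circ> \<pi>) = f g"
    proof (rule permutes_transpose_invariant[OF _ \<pi>])
      fix p a b
      assume p: "p permutes V - {i}" "a \<in> V - {i}" "b \<in> V - {i}" "a \<noteq> b"
      have gp: "g \<circ> p permutes V"
        using gh permutes_subset[OF p(1)] by (intro permutes_compose) auto
      have "(g \<circ> p) i = g i" using permutes_not_in[OF p(1)] by simp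
      then show "f (g \<circ> p \<circ> transpose a b) = f (g \<circ> p)"
        using diff_eq[OF gp, of a b] zero[OF p(2,3) gp] p by auto
    qed (use fin in auto)
    then show ?thesis by (simp add: h_eq)
  qed
  have inV: "g x \<in> V" if "g permutes V" "x \<in> V" for g x
    using that permutes_in_image by metis
  from diff_concentrated show ?thesis
  proof (elim disjE bexE)
    fix i
    assume i: "i \<in> V" "\<forall>a\<in>V. \<forall>b\<in>V. a \<noteq> i \<longrightarrow> b \<noteq> i \<longrightarrow> (\<forall>x\<in>V. \<forall>y\<in>V. diff a b x y = 0)"
    have "f g = f h" if "g permutes V" "h permutes V" "g i = h i" for g h
      using that i inV by (intro move[of g h i]) auto
    then show ?thesis using i by blast
  next
    fix j
    assume j: "j \<in> V"
      "\<forall>a\<in>V. \<forall>b\<in>V. \<forall>x\<in>V. \<forall>y\<in>V. x \<noteq> j \<longrightarrow> y \<noteq> j \<longrightarrow> diff a b x y = 0"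
    have "f g = f h" if gh: "g permutes V" "h permutes V" "inv g j = inv h j" for g h
    \<comment> \<open>The position that holds \<open>j\<close> takes the role of \<open>i\<close>;
      all other positions have values different from \<open>j\<close>.\<close>
    proof (rule move[of g h "inv g j"])
      show "g (inv g j) = h (inv g j)"
        using gh by (metis permutes_inverses(1))
      fix a b g'
      assume ab: "a \<in> V - {inv g j}" "b \<in> V - {inv g j}"
        and g': "g' permutes V" "g' (inv g j) = g (inv g j)"
      have "g' (inv g j) = j" using g' gh permutes_inverses(1) by metis
      then have "g' a \<noteq> j" "g' b \<noteq> j" using ab permutes_inj[OF g'(1)] by (metis DiffD2 injD singletonI)+
      then show "diff a b (g' a) (g' b) = 0" using j ab g' inV by auto
    qed (use gh in auto)
    then show ?thesis using j by blast
  qed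
qed

end

subsection \<open>Extremal families\<close>

lemma card_permutations_value_in:
  assumes fin: "finite V" and i: "i \<in> V" and J: "J \<subseteq> V"
  shows "card {p. p permutes V \<and> p i \<in> J} = card J * fact (card V - 1)"
proof -
  have one: "card {p. p permutes V \<and> p i = j} = fact (card V - 1)" if j: "j \<in> V" for j
  proof -
    have "bij_betw ((\<circ>) (transpose i j)) {p. p permutes V \<and> p i = j} {p. p permutes V - {i}}"
    proof (rule bij_betw_byWitness[where f' = "(\<circ>) (transpose i j)"])
      show "(\<circ>) (transpose i j) ` {p. p permutes V \<and> p i = j} \<subseteq> {p. p permutes V - {i}}"
      proof clarify
        fix p assume p: "p permutes V" "j = p i"
        have "transpose i (p i) \<circ> p permutes V"
          using p i j by (intro permutes_compose permutes_swap_id) auto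
        then show "transpose i (p i) \<circ> p permutes V - {i}"
          by (rule permutes_superset) auto
      qed
      show "(\<circ>) (transpose i j) ` {p. p permutes V - {i}} \<subseteq> {p. p permutes V \<and> p i = j}"
      proof clarify
        fix p assume p: "p permutes V - {i}"
        then have "transpose i j \<circ> p permutes V"
          using i j by (intro permutes_compose permutes_swap_id permutes_subset[OF p]) auto
        then show "transpose i j \<circ> p permutes V \<and> (transpose i j \<circ> p) i = j"
          using permutes_not_in[OF p, of i] by simp
      qed
    qed (auto simp: fun_eq_iff)
    then have "card {p. p permutes V \<and> p i = j} = card {p. p permutes V - {i}}"
      by (rule bij_betw_same_card)
    also have "\<dots> = fact (card V - 1)"
      using fin i by (intro card_permutations) auto
    finally show ?thesis .
  qed
  have finJ: "finite J" using J fin finite_subset by blast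
  have "{p. p permutes V \<and> p i \<in> J} = (\<Union>j\<in>J. {p. p permutes V \<and> p i = j})" by auto
  also have "card \<dots> = (\<Sum>j\<in>J. card {p. p permutes V \<and> p i = j})"
    using finJ fin finite_permutations[OF fin] by (intro card_UN_disjoint) auto
  also have "\<dots> = (\<Sum>j\<in>J. fact (card V - 1))"
    using J by (intro sum.cong one) auto
  finally show ?thesis by simp
qed

lemma card_permutations_inv_value_in:
  assumes "finite V" "j \<in> V" "I \<subseteq> V"
  shows "card {p. p permutes V \<and> inv p j \<in> I} = card I * fact (card V - 1)"
proof -
  have "bij_betw inv {p. p permutes V \<and> inv p j \<in> I} {p. p permutes V \<and> p j \<in> I}"
    by (rule bij_betw_byWitness[where f' = inv])
      (auto simp: permutes_inv_inv intro: permutes_inv)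
  then show ?thesis
    using card_permutations_value_in[OF assms] by (simp add: bij_betw_same_card)
qed

text \<open>The factorial is 1 or 2, so a single agreement yields \<open>i\<close>, and equal
  cardinalities turn inclusion into equality.\<close>

lemma intersecting_family_small:
  assumes fin: "finite V" and V: "card V = 2 \<or> card V = 3"
    and G: "G \<subseteq> {p. p permutes V}" "card G = fact (card V - 1)"
    and agree: "\<And>g h. g \<in> G \<Longrightarrow> h \<in> G \<Longrightarrow> \<exists>x\<in>V. g x = h x"
  shows "\<exists>i\<in>V. \<exists>j\<in>V. G = {p. p permutes V \<and> p i = j}"
proof -
  have "card G = 1 \<or> card G = 2" using V G(2) by (auto simp: fact_numeral)
  then obtain g h where gh: "G = {g, h}"
    by (metis card_1_singletonE card_2_iff insert_absorb2)
  then obtain i where i: "i \<in> V" "g i = h i" using agree[of g h] by auto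
  have j: "g i \<in> V" using i gh G(1) permutes_in_image by fastforce
  have "G = {p. p permutes V \<and> p i \<in> {g i}}"
  proof (rule card_subset_eq)
    show "finite {p. p permutes V \<and> p i \<in> {g i}}"
      using finite_permutations[OF fin] by simp
    show "G \<subseteq> {p. p permutes V \<and> p i \<in> {g i}}" using gh i G(1) by auto
    show "card G = card {p. p permutes V \<and> p i \<in> {g i}}"
      using card_permutations_value_in[OF fin i(1), of "{g i}"] j G(2) by simp
  qed
  then show ?thesis using i j by auto
qed

lemma extremal_family_dictator:
  assumes fin: "finite V" and s: "2 \<le> s" "s \<le> card V" and F: "F \<subseteq> {p. p permutes V}"
    and matching: "\<And>L. latin_rectangle V L \<Longrightarrow> card (F \<inter> L) \<le> s - 1"
    and extremal: "card F = (s - 1) * fact (card V - 1)"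
  shows "(\<exists>i\<in>V. \<forall>g h. g permutes V \<longrightarrow> h permutes V \<longrightarrow> g i = h i \<longrightarrow> (g \<in> F \<longleftrightarrow> h \<in> F)) \<or>
    (\<exists>j\<in>V. \<forall>g h. g permutes V \<longrightarrow> h permutes V \<longrightarrow> inv g j = inv h j \<longrightarrow> (g \<in> F \<longleftrightarrow> h \<in> F))"
proof -
  have ne: "V \<noteq> {}" using s by auto
  have exact: "card (F \<inter> L) = s - 1" if "latin_rectangle V L" "card L = card V" for L
    using latin_intersection_average(2)[OF fin ne F matching extremal that] .
  have finL: "finite L" if "card L = card V" for L :: "('a \<Rightarrow> 'a) set"
    using that s by (intro card_ge_0_finite) simp
  show ?thesis
  proof (cases "card V \<ge> 4")
    case True
    define f :: "('a \<Rightarrow> 'a) \<Rightarrow> int" where "f = (\<lambda>g. if g \<in> F then 1 else 0)"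
    interpret constant_on_latin V f "int (s - 1)"
    proof
      fix L assume L: "latin_rectangle V L" "card L = card V"
      have "(\<Sum>p\<in>L. f p) = int (card (F \<inter> L))"
        unfolding f_def using finL[OF L(2)] by (simp add: sum.If_cases Int_commute)
      then show "(\<Sum>p\<in>L. f p) = int (s - 1)" using exact[OF L] by simp
    qed (rule fin)
    interpret boolean_mixed_zero V f
    proof
      show "f g - f (g \<circ> transpose a b) = f (g \<circ> transpose c d) - f (g \<circ> transpose c d \<circ> transpose a b)"
        if "g permutes V" "a \<in> V" "b \<in> V" "c \<in> V" "d \<in> V" "distinct [a, b, c, d]" for g a b c d
        using mixed_eq_0[OF True that] unfolding mixed_def by linarith
    qed (use fin True in \<open>auto simp: f_def\<close>)
    have "f g = f h \<longleftrightarrow> (g \<in> F \<longleftrightarrow> h \<in> F)" for g h by (simp add: f_def)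
    then show ?thesis using dictator by simp
  next
    case False
    then have V: "card V = 2 \<or> card V = 3" using s by linarith
    show ?thesis
    proof (cases "s = 2")
      case True
      have "\<exists>x\<in>V. g x = h x" if gh: "g \<in> F" "h \<in> F" for g h
      proof (rule ccontr)
        assume disj: "\<not> (\<exists>x\<in>V. g x = h x)"
        then have "latin_rectangle V {g, h}"
          using gh F by (intro latin_rectangle_doubleton) auto
        moreover have "F \<inter> {g, h} = {g, h}" "g \<noteq> h" using gh disj ne by auto
        ultimately show False using matching[of "{g, h}"] True by simp
      qed
      then obtain i j where ij: "i \<in> V" "F = {p. p permutes V \<and> p i = j}"
        using intersecting_family_small[OF fin V F] extremal True by auto
      have "g \<in> F \<longleftrightarrow> h \<in> F" if "g permutes V" "h permutes V" "g i = h i" for g h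
        using that ij by simp
      then show ?thesis using ij(1) by blast
    next
      case False
      then have s_eq: "s = card V" using V s by auto
      \<comment> \<open>Two disjoint members of the complement would extend to a Latin square with
        at most \<open>card V - 2\<close> rows in \<open>F\<close>, whereas exactly
        \<open>card V - 1\<close> are required.\<close>
      define G where "G = {p. p permutes V} - F"
      have "card G = fact (card V) - (card V - 1) * fact (card V - 1)"
        unfolding G_def using F extremal s_eq finite_permutations[OF fin]
        by (simp add: card_Diff_subset finite_subset card_permutations[OF _ fin])
      also have "\<dots> = fact (card V - 1)" using V by (auto simp: fact_numeral)
      finally have cardG: "card G = fact (card V - 1)" .
      have "\<exists>x\<in>V. g x = h x" if gh: "g \<in> G" "h \<in> G" for g h
      proof (rule ccontr)
        assume disj: "\<not> (\<exists>x\<in>V. g x = h x)"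
        then have "latin_rectangle V {g, h}" and gh_ne: "g \<noteq> h"
          using gh ne by (auto intro!: latin_rectangle_doubleton simp: G_def)
        then obtain M where M: "{g, h} \<subseteq> M" "latin_rectangle V M" "card M = card V"
          using latin_rectangle_complete[OF fin, of "{g, h}"] s by auto
        have "card (F \<inter> M) \<le> card (M - {g, h})"
          using gh finL[OF M(3)] by (intro card_mono) (auto simp: G_def)
        also have "\<dots> = card V - 2" using M gh_ne by (simp add: card_Diff_subset)
        finally show False using exact[OF M(2,3)] s s_eq by simp
      qed
      then obtain i j where ij: "i \<in> V" "G = {p. p permutes V \<and> p i = j}"
        using intersecting_family_small[OF fin V _ cardG] by (auto simp: G_def)
      have "g \<in> F \<longleftrightarrow> h \<in> F" if "g permutes V" "h permutes V" "g i = h i" for g h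
      proof -
        have "p \<in> F \<longleftrightarrow> p i \<noteq> j" if "p permutes V" for p
          using that ij(2) by (auto simp: G_def)
        then show ?thesis using that by simp
      qed
      then show ?thesis using ij(1) by blast
    qed
  qed
qed

section \<open>The bound and the equality case in \<open>Sym n\<close>\<close>

theorem theorem1p1:
  fixes n s :: nat and F :: "(nat \<Rightarrow> nat) set"
  assumes "2 \<le> s" and "s \<le> n"
    and "F \<subseteq> Sym n"
    and "matching_number n F < s"
  shows "card F \<le> (s - 1) * fact (n - 1) \<and>
    (card F = (s - 1) * fact (n - 1) \<longleftrightarrow>
      (\<exists>i\<in>{1..n}. \<exists>J\<subseteq>{1..n}. card J = s - 1 \<and> F = {\<sigma> \<in> Sym n. \<sigma> i \<in> J}) \<or>
      (\<exists>j\<in>{1..n}. \<exists>I\<subseteq>{1..n}. card I = s - 1 \<and> F = {\<sigma> \<in> Sym n. inv \<sigma> j \<in> I}))"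
proof -
  let ?V = "{1..n}"
  have finF: "finite F" using assms(3) finite_permutations[of ?V] finite_subset by blast
  have matching: "card (F \<inter> L) \<le> s - 1" if L: "latin_rectangle ?V L" for L
  proof -
    have "pairwise (disjoint_perms n) (F \<inter> L)"
      using L unfolding latin_rectangle_def disjoint_perms_def by (auto intro: pairwise_subset)
    then have "card (F \<inter> L) \<in> {card G |G. G \<subseteq> F \<and> pairwise (disjoint_perms n) G}" by blast
    moreover have "finite {card G |G. G \<subseteq> F \<and> pairwise (disjoint_perms n) G}"
      by (rule finite_subset[of _ "card ` Pow F"]) (use finF in auto)
    ultimately have "card (F \<inter> L) \<le> matching_number n F"
      unfolding matching_number_def by (rule Max_ge[rotated])
    then show ?thesis using assms(4) by simp
  qed
  have V: "?V \<noteq> {}" using assms by auto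
  have upper: "card F \<le> (s - 1) * fact (n - 1)"
    using latin_intersection_average(1)[OF _ V assms(3) matching] by simp
  have card_value: "card {\<sigma> \<in> Sym n. \<sigma> i \<in> J} = card J * fact (n - 1)" if "i \<in> ?V" "J \<subseteq> ?V" for i J
    using card_permutations_value_in[OF _ that] by simp
  have card_inv_value: "card {\<sigma> \<in> Sym n. inv \<sigma> j \<in> I} = card I * fact (n - 1)" if "j \<in> ?V" "I \<subseteq> ?V" for j I
    using card_permutations_inv_value_in[OF _ that] by simp
  have "(\<exists>i\<in>?V. \<exists>J\<subseteq>?V. card J = s - 1 \<and> F = {\<sigma> \<in> Sym n. \<sigma> i \<in> J}) \<or>
      (\<exists>j\<in>?V. \<exists>I\<subseteq>?V. card I = s - 1 \<and> F = {\<sigma> \<in> Sym n. inv \<sigma> j \<in> I})"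
    if extremal: "card F = (s - 1) * fact (n - 1)"
  proof -
    have "(\<exists>i\<in>?V. \<forall>g h. g permutes ?V \<longrightarrow> h permutes ?V \<longrightarrow> g i = h i \<longrightarrow> (g \<in> F \<longleftrightarrow> h \<in> F)) \<or>
      (\<exists>j\<in>?V. \<forall>g h. g permutes ?V \<longrightarrow> h permutes ?V \<longrightarrow> inv g j = inv h j \<longrightarrow> (g \<in> F \<longleftrightarrow> h \<in> F))"
    proof (rule extremal_family_dictator[OF _ assms(1) _ assms(3) matching])
      show "s \<le> card ?V" using assms(2) by simp
      show "card F = (s - 1) * fact (card ?V - 1)" using extremal by simp
    qed simp_all
    then show ?thesis
    proof (elim disjE bexE)
      fix i
      assume i: "i \<in> ?V"
        and dep: "\<forall>g h. g permutes ?V \<longrightarrow> h permutes ?V \<longrightarrow> g i = h i \<longrightarrow> (g \<in> F \<longleftrightarrow> h \<in> F)"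
      \<comment> \<open>\<open>J\<close> collects the values that \<open>F\<close> attains at
        \<open>i\<close>. As membership depends on that value alone, \<open>F\<close> contains every
        permutation with value in \<open>J\<close>, and counting gives
        \<open>card J\<close>.\<close>
      define J where "J = (\<lambda>\<sigma>. \<sigma> i) ` F"
      have J: "J \<subseteq> ?V" unfolding J_def using assms(3) i permutes_in_image[of _ ?V i] by auto
      have F_eq: "F = {\<sigma> \<in> Sym n. \<sigma> i \<in> J}"
      proof (intro equalityI subsetI)
        fix \<sigma> assume "\<sigma> \<in> F"
        then show "\<sigma> \<in> {\<sigma> \<in> Sym n. \<sigma> i \<in> J}" using assms(3) by (auto simp: J_def)
      next
        fix \<sigma> assume "\<sigma> \<in> {\<sigma> \<in> Sym n. \<sigma> i \<in> J}"
        then obtain \<tau> where "\<tau> \<in> F" "\<sigma> i = \<tau> i" "\<sigma> permutes ?V" by (auto simp: J_def)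
        moreover from this have "\<tau> permutes ?V" using assms(3) by auto
        ultimately show "\<sigma> \<in> F" using dep by metis
      qed
      have "card J = s - 1" using extremal card_value[OF i J, folded F_eq] by simp
      then have "J \<subseteq> ?V \<and> card J = s - 1 \<and> F = {\<sigma> \<in> Sym n. \<sigma> i \<in> J}"
        using J F_eq by simp
      then show ?thesis using i by (intro disjI1 bexI exI)
    next
      fix j
      assume j: "j \<in> ?V"
        and dep: "\<forall>g h. g permutes ?V \<longrightarrow> h permutes ?V \<longrightarrow> inv g j = inv h j \<longrightarrow> (g \<in> F \<longleftrightarrow> h \<in> F)"
      define I where "I = (\<lambda>\<sigma>. inv \<sigma> j) ` F"
      have I: "I \<subseteq> ?V" unfolding I_def using assms(3) j permutes_in_image[OF permutes_inv, of _ ?V j] by auto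
      have F_eq: "F = {\<sigma> \<in> Sym n. inv \<sigma> j \<in> I}"
      proof (intro equalityI subsetI)
        fix \<sigma> assume "\<sigma> \<in> F"
        then show "\<sigma> \<in> {\<sigma> \<in> Sym n. inv \<sigma> j \<in> I}" using assms(3) by (auto simp: I_def)
      next
        fix \<sigma> assume "\<sigma> \<in> {\<sigma> \<in> Sym n. inv \<sigma> j \<in> I}"
        then obtain \<tau> where "\<tau> \<in> F" "inv \<sigma> j = inv \<tau> j" "\<sigma> permutes ?V" by (auto simp: I_def)
        moreover from this have "\<tau> permutes ?V" using assms(3) by auto
        ultimately show "\<sigma> \<in> F" using dep by metis
      qed
      have "card I = s - 1" using extremal card_inv_value[OF j I, folded F_eq] by simp
      then have "I \<subseteq> ?V \<and> card I = s - 1 \<and> F = {\<sigma> \<in> Sym n. inv \<sigma> j \<in> I}"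
        using I F_eq by simp
      then show ?thesis using j by (intro disjI2 bexI exI)
    qed
  qed
  moreover have "card F = (s - 1) * fact (n - 1)"
    if "(\<exists>i\<in>?V. \<exists>J\<subseteq>?V. card J = s - 1 \<and> F = {\<sigma> \<in> Sym n. \<sigma> i \<in> J}) \<or>
      (\<exists>j\<in>?V. \<exists>I\<subseteq>?V. card I = s - 1 \<and> F = {\<sigma> \<in> Sym n. inv \<sigma> j \<in> I})"
    using that
  proof (elim disjE bexE exE conjE)
    fix i J assume *: "i \<in> ?V" "J \<subseteq> ?V" "card J = s - 1" "F = {\<sigma> \<in> Sym n. \<sigma> i \<in> J}"
    show "card F = (s - 1) * fact (n - 1)" unfolding *(4) card_value[OF *(1,2)] *(3) ..
  next
    fix j I assume *: "j \<in> ?V" "I \<subseteq> ?V" "card I = s - 1" "F = {\<sigma> \<in> Sym n. inv \<sigma> j \<in> I}"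
    show "card F = (s - 1) * fact (n - 1)" unfolding *(4) card_inv_value[OF *(1,2)] *(3) ..
  qed
  ultimately show ?thesis using upper by (intro conjI iffI) assumption+
qed

end
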